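(* Let $n\ge 3$, let $\Bbbk$ be a field of characteristic zero, let $S=\Bbbk[x_1,\ldots,x_n]$ with the standard grading, let $\ell=x_1+\cdots+x_n$, and let $d\ge 3$. Let $I\subset S$ be an ideal belonging to one of the following three classes: (a) artinian ideals generated in degree $d$; (b) artinian monomial ideals $I=(m_1,\ldots,m_s)$, with $m_1,\ldots,m_s$ monomials such that $\min_k\{\deg(m_k)\}=d$; (c) artinian ideals $I=(f_1,\ldots,f_s)$, with $f_1,\ldots,f_s$ homogeneous polynomials such that $\min_k\{\deg(f_k)\}=d$. Put $R=S/I$ and let $\mathrm{HF}(R,d)=\dim_\Bbbk R_d$ be the value of the Hilbert function of $R$ in degree $d$. (i) Assume that $R$ fails the Strong Lefschetz property. Then $\mathrm{HF}(R,d)\ge 3$. Moreover, this is sharp in the sense that, for each of the three classes and for any $d\ge 3$, there is an example belonging to that class, with $\mathrm{HF}(R,d)=3$, for which $\ell^{d-1}:R_1\to R_d$ fails to be surjective. (ii) Let $1\le i\le d-1$. If $\ell^i$ fails to have maximal rank in some degree (that is, for some $j\ge 0$ the multiplication map $\ell^i:R_j\to R_{j+i}$ is neither injective nor surjective), then $$\mathrm{HF}(R,d)\ \ge\ d-i+2.$$ Moreover, the bound is sharp for every $2\le i\le d-1$: for each of the three classes there is an example in that class where $\ell^i:R_{d-i}\to R_d$ is not surjective and the bound is achieved, i.e. $\mathrm{HF}(R,d)=d-i+2$.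
   Context: An ideal $I$ is artinian if $S/I$ is a finite-dimensional $\Bbbk$-vector space. An ideal is generated in degree $d$ if it is generated by homogeneous polynomials of degree $d$. $R_j$ denotes the degree $j$ graded piece of $R$. A linear map has maximal rank if it is injective or surjective. Maps written $\ell^i:R_j\to R_{j+i}$ are multiplication by $\ell^i$. An artinian graded algebra $R$ has the Strong Lefschetz property (SLP) if there is a linear form $\ell'$ such that for all $i\ge 1$ and all $j\ge 0$ the multiplication map $(\ell')^{i}:R_j\to R_{j+i}$ has maximal rank; otherwise $R$ fails the SLP.
   Formalization: In (ii), for classes (a) and (c), it is assumed that for every linear form ℓ' the power ℓ'^i fails maximal rank in some degree, not only for ℓ=x_1+...+x_n; with that ℓ alone the bound is false (take I generated by all cubics vanishing at (1,-1,0) and all quartics, n=d=3). *)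

theory Defs
  imports
    "HOL-Library.Poly_Mapping"
    "HOL-Algebra.Embedded_Algebras"
    "HOL-Algebra.Algebraic_Closure_Type"
    "HOL-Algebra.QuotRing"
begin

text \<open>
  The polynomial ring over \<open>'k\<close> in variables indexed by the finite type \<open>'n\<close>: exponent vectors
  are finitely supported maps \<open>'n \<Rightarrow>\<^sub>0 nat\<close>, and multiplication on \<open>mvpoly\<close> is convolution.
  \<open>S_ring\<close> repackages the type as a ring record, so that ideals, quotient rings and dimensions
  are those of HOL-Algebra.
\<close>

type_synonym ('n, 'k) mvpoly = "('n \<Rightarrow>\<^sub>0 nat) \<Rightarrow>\<^sub>0 'k"

abbreviation S_ring :: "('n::finite, 'k::field_char_0) mvpoly ring" where
  "S_ring \<equiv> ring_of_type_algebra"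

definition monomial :: "('n::finite \<Rightarrow>\<^sub>0 nat) \<Rightarrow> ('n, 'k::field_char_0) mvpoly" where
  "monomial m = Poly_Mapping.single m 1"

definition var :: "'n::finite \<Rightarrow> ('n, 'k::field_char_0) mvpoly" where
  "var v = monomial (Poly_Mapping.single v 1)"

definition mon_deg :: "('n::finite \<Rightarrow>\<^sub>0 nat) \<Rightarrow> nat" where
  "mon_deg m = (\<Sum>v\<in>UNIV. Poly_Mapping.lookup m v)"

text \<open>The graded piece \<open>S\<^sub>j\<close>, which contains \<open>0\<close>.\<close>

definition S_piece :: "nat \<Rightarrow> ('n::finite, 'k::field_char_0) mvpoly set" where
  "S_piece j = {p. \<forall>m\<in>Poly_Mapping.keys p. mon_deg m = j}"

text \<open>Only meaningful for nonzero polynomials.\<close>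

definition poly_deg :: "('n::finite, 'k::field_char_0) mvpoly \<Rightarrow> nat" where
  "poly_deg p = Max (mon_deg ` Poly_Mapping.keys p)"

definition ell :: "('n::finite, 'k::field_char_0) mvpoly" where
  "ell = (\<Sum>v\<in>UNIV. var v)"


text \<open>The graded algebra \<open>R = S/I\<close>, its base field and its graded pieces.\<close>

abbreviation R_ring :: "('n::finite, 'k::field_char_0) mvpoly set \<Rightarrow> ('n, 'k) mvpoly set ring" where
  "R_ring I \<equiv> S_ring Quot I"

definition cls :: "('n::finite, 'k::field_char_0) mvpoly set \<Rightarrow> ('n, 'k) mvpoly \<Rightarrow> ('n, 'k) mvpoly set" where
  "cls I p = I +>\<^bsub>S_ring\<^esub> p"

definition scalars :: "('n::finite, 'k::field_char_0) mvpoly set \<Rightarrow> ('n, 'k) mvpoly set set" where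
  "scalars I = range (\<lambda>c. cls I (Poly_Mapping.single 0 c))"

definition R_piece :: "('n::finite, 'k::field_char_0) mvpoly set \<Rightarrow> nat \<Rightarrow> ('n, 'k) mvpoly set set" where
  "R_piece I j = cls I ` S_piece j"

definition HF :: "('n::finite, 'k::field_char_0) mvpoly set \<Rightarrow> nat \<Rightarrow> nat" where
  "HF I j = ring.dim (R_ring I) (scalars I) (R_piece I j)"

definition artinian :: "('n::finite, 'k::field_char_0) mvpoly set \<Rightarrow> bool" where
  "artinian I \<longleftrightarrow>
     ideal I S_ring \<and> ring.finite_dimension (R_ring I) (scalars I) (carrier (R_ring I))"


text \<open>The map \<open>f : R\<^sub>j \<rightarrow> R\<^sub>k\<close> given by multiplication by the class of \<open>f\<close>, where \<open>f \<in> S\<^bsub>k-j\<^esub>\<close>.\<close>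

definition mult_map ::
  "('n::finite, 'k::field_char_0) mvpoly set \<Rightarrow> ('n, 'k) mvpoly \<Rightarrow>
   ('n, 'k) mvpoly set \<Rightarrow> ('n, 'k) mvpoly set" where
  "mult_map I f r = cls I f \<otimes>\<^bsub>R_ring I\<^esub> r"

definition mult_inj ::
  "('n::finite, 'k::field_char_0) mvpoly set \<Rightarrow> ('n, 'k) mvpoly \<Rightarrow> nat \<Rightarrow> bool" where
  "mult_inj I f j \<longleftrightarrow> inj_on (mult_map I f) (R_piece I j)"

definition mult_surj ::
  "('n::finite, 'k::field_char_0) mvpoly set \<Rightarrow> ('n, 'k) mvpoly \<Rightarrow> nat \<Rightarrow> nat \<Rightarrow> bool" where
  "mult_surj I f j k \<longleftrightarrow> mult_map I f ` R_piece I j = R_piece I k"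

definition max_rank ::
  "('n::finite, 'k::field_char_0) mvpoly set \<Rightarrow> ('n, 'k) mvpoly \<Rightarrow> nat \<Rightarrow> nat \<Rightarrow> bool" where
  "max_rank I f j k \<longleftrightarrow> mult_inj I f j \<or> mult_surj I f j k"

definition SLP :: "('n::finite, 'k::field_char_0) mvpoly set \<Rightarrow> bool" where
  "SLP I \<longleftrightarrow> (\<exists>l\<in>S_piece 1. \<forall>i\<ge>1. \<forall>j. max_rank I (l ^ i) j (j + i))"


definition artinian_gen_in_degree :: "nat \<Rightarrow> ('n::finite, 'k::field_char_0) mvpoly set set" where
  "artinian_gen_in_degree d =
     {I. artinian I \<and> (\<exists>F. F \<subseteq> S_piece d \<and> I = Idl\<^bsub>S_ring\<^esub> F)}"

definition artinian_monomial :: "nat \<Rightarrow> ('n::finite, 'k::field_char_0) mvpoly set set" where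
  "artinian_monomial d =
     {I. artinian I \<and>
         (\<exists>M. finite M \<and> M \<noteq> {} \<and> Min (mon_deg ` M) = d \<and> I = Idl\<^bsub>S_ring\<^esub> (monomial ` M))}"

definition artinian_homogeneous :: "nat \<Rightarrow> ('n::finite, 'k::field_char_0) mvpoly set set" where
  "artinian_homogeneous d =
     {I. artinian I \<and>
         (\<exists>F. finite F \<and> F \<noteq> {} \<and> (\<forall>f\<in>F. f \<noteq> 0 \<and> (\<exists>e. f \<in> S_piece e)) \<and>
              Min (poly_deg ` F) = d \<and> I = Idl\<^bsub>S_ring\<^esub> F)}"

end

theory Submission
  imports Defs "HOL-Computational_Algebra.Polynomial"
begin

text \<open>
  If \<open>\<ell>\<^sup>i : R\<^bsub>d-i\<^esub> \<rightarrow> R\<^sub>d\<close> is surjective, then \<open>\<ell>\<^sup>i\<close> is surjective onto every \<open>R\<^sub>k\<close> with \<open>k \<ge> d\<close>, while below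
  degree \<open>d\<close> it is injective because \<open>R\<close> agrees with the domain \<open>S\<close> there. So everything reduces to
  surjectivity onto \<open>R\<^sub>d\<close>. Consider the linear forms \<open>\<ell>\<^sub>t = \<Sum>\<^sub>v t\<^bsup>w v\<^esup> x\<^sub>v\<close> for weights \<open>w\<close> that separate the
  monomials of degree \<open>d\<close>. A functional \<open>\<phi>\<close> on \<open>S\<close> killing \<open>I\<close> and the multiples of \<open>\<ell>\<^sub>t\<^sup>i\<close> yields the
  univariate polynomial \<open>\<phi>((\<Sum>\<^sub>v x\<^sub>v T\<^bsup>w v\<^esup>)\<^sup>d)\<close>, which vanishes to order at least \<open>d - i + 1\<close> at \<open>T = t\<close>
  and lies in a space of dimension \<open>HF(R, d)\<close> that does not depend on \<open>t\<close>. In characteristic zero a space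
  of polynomials of dimension \<open>c\<close> contains a nonzero member vanishing to order \<open>c\<close> at \<open>t\<close> only for
  finitely many \<open>t\<close> (a Wronskian argument), and if the space is spanned by \<open>c\<close> powers of \<open>T\<close>, then
  \<open>t = 1\<close> is never exceptional. Hence \<open>HF(R, d) \<le> d - i + 1\<close> forces \<open>\<phi> = 0\<close> in degree \<open>d\<close>, for generic \<open>t\<close>
  in general and for \<open>t = 1\<close>, that is \<open>\<ell> = x\<^sub>1 + \<cdots> + x\<^sub>n\<close>, if \<open>I\<close> is monomial.
\<close>

section \<open>Graded pieces and ideals of the polynomial ring\<close>

abbreviation const :: "'k::field_char_0 \<Rightarrow> ('n::finite, 'k) mvpoly" where
  "const c \<equiv> Poly_Mapping.single 0 c"

lemma mvpoly_induct [case_names zero single add]: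
  fixes p :: "('n::finite, 'k::field_char_0) mvpoly"
  assumes "P 0" "\<And>m c. P (Poly_Mapping.single m c)" "\<And>p q. P p \<Longrightarrow> P q \<Longrightarrow> P (p + q)"
  shows "P p"
proof -
  have "p = (\<Sum>m\<in>Poly_Mapping.keys p. Poly_Mapping.single m (Poly_Mapping.lookup p m))"
    by (rule poly_mapping_eqI) (auto simp: lookup_sum lookup_single when_def in_keys_iff)
  moreover have "P (\<Sum>m\<in>A. Poly_Mapping.single m (Poly_Mapping.lookup p m))" if "finite A" for A
    using that by induction (auto intro: assms)
  ultimately show ?thesis by (metis finite_keys)
qed

lemma mon_deg_zero [simp]: "mon_deg 0 = 0"
  by (simp add: mon_deg_def)

lemma mon_deg_add [simp]: "mon_deg (a + b) = mon_deg a + mon_deg b"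
  by (simp add: mon_deg_def lookup_add sum.distrib)

lemma mon_deg_single [simp]: "mon_deg (Poly_Mapping.single v k) = k"
  by (simp add: mon_deg_def lookup_single when_def)

lemma mon_deg_eq_0 [simp]: "mon_deg m = 0 \<longleftrightarrow> m = 0"
  by (auto simp: mon_deg_def intro: poly_mapping_eqI)

lemma single_eq_const_mult: "Poly_Mapping.single m c = const c * monomial m"
  by (simp add: monomial_def mult_single)

lemma lookup_const_mult [simp]:
  "Poly_Mapping.lookup (const c * p) m = c * Poly_Mapping.lookup p m"
  by (induction p rule: mvpoly_induct)
     (auto simp: mult_single lookup_single when_def lookup_add algebra_simps)

lemma monomial_add: "monomial (a + b) = monomial a * monomial b"
  by (simp add: monomial_def mult_single)

lemma S_piece_0 [simp]: "0 \<in> S_piece j"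
  by (simp add: S_piece_def)

lemma S_piece_add: "p \<in> S_piece j \<Longrightarrow> q \<in> S_piece j \<Longrightarrow> p + q \<in> S_piece j"
  using keys_add[of p q] by (auto simp: S_piece_def)

lemma S_piece_sum: "(\<And>x. x \<in> A \<Longrightarrow> f x \<in> S_piece j) \<Longrightarrow> sum f A \<in> S_piece j"
  by (induction A rule: infinite_finite_induct) (auto intro: S_piece_add)

lemma S_piece_single: "mon_deg m = j \<Longrightarrow> Poly_Mapping.single m c \<in> S_piece j"
  by (simp add: S_piece_def)

lemma S_piece_mult: "p \<in> S_piece i \<Longrightarrow> q \<in> S_piece j \<Longrightarrow> p * q \<in> S_piece (i + j)"
  unfolding S_piece_def using keys_mult[of p q] mon_deg_add by (smt (verit) mem_Collect_eq subsetD)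

lemma S_piece_const_mult: "q \<in> S_piece j \<Longrightarrow> const c * q \<in> S_piece j"
  using S_piece_mult[of "const c" 0 q j] by (simp add: S_piece_single)

lemma S_piece_uminus: "p \<in> S_piece j \<Longrightarrow> - p \<in> S_piece j"
  by (auto simp: S_piece_def in_keys_iff)

lemma S_piece_diff: "p \<in> S_piece j \<Longrightarrow> q \<in> S_piece j \<Longrightarrow> p - q \<in> S_piece j"
  using S_piece_add[OF _ S_piece_uminus, of p j q] by simp

lemma S_piece_power: "l \<in> S_piece 1 \<Longrightarrow> l ^ i \<in> S_piece i"
proof (induction i)
  case 0
  then show ?case by (simp add: S_piece_def)
next
  case (Suc i)
  then show ?case using S_piece_mult[of l 1 "l ^ i" i] by simp
qed

lemma monomial_in_S_piece: "monomial m \<in> S_piece j \<longleftrightarrow> mon_deg m = j"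
  by (simp add: S_piece_def monomial_def)

lemma ell_in_S_piece: "ell \<in> S_piece 1"
  unfolding ell_def var_def by (rule S_piece_sum) (simp add: monomial_in_S_piece)

section \<open>Homogeneous components\<close>

definition hcomp :: "nat \<Rightarrow> ('n::finite, 'k::field_char_0) mvpoly \<Rightarrow> ('n, 'k) mvpoly" where
  "hcomp j p = (\<Sum>m\<in>{m\<in>Poly_Mapping.keys p. mon_deg m = j}.
     Poly_Mapping.single m (Poly_Mapping.lookup p m))"

lemma lookup_hcomp:
  "Poly_Mapping.lookup (hcomp j p) m = (Poly_Mapping.lookup p m when mon_deg m = j)"
  by (auto simp: hcomp_def lookup_sum lookup_single when_def in_keys_iff)

lemma hcomp_in_S_piece: "hcomp j p \<in> S_piece j"
  by (auto simp: S_piece_def in_keys_iff lookup_hcomp)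

lemma hcomp_add: "hcomp j (p + q) = hcomp j p + hcomp j q"
  by (rule poly_mapping_eqI) (simp add: lookup_hcomp lookup_add when_add_distrib)

lemma hcomp_0 [simp]: "hcomp j 0 = 0"
  by (simp add: hcomp_def)

lemma hcomp_S_piece: "p \<in> S_piece i \<Longrightarrow> hcomp j p = (if i = j then p else 0)"
  by (rule poly_mapping_eqI) (auto simp: lookup_hcomp S_piece_def in_keys_iff when_def)

text \<open>Both sides are additive in \<open>p\<close>, so a single term suffices, and there
  multiplication by \<open>q\<close> shifts the degree by \<open>i\<close>. In degrees below
  \<open>i\<close> the product has no component, hence the case distinction.\<close>

lemma hcomp_mult:
  assumes "q \<in> S_piece i"
  shows "hcomp k (q * p) = (if i \<le> k then q * hcomp (k - i) p else 0)"
proof (induction p rule: mvpoly_induct)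
  case (single m c)
  have "q * Poly_Mapping.single m c \<in> S_piece (i + mon_deg m)"
    by (rule S_piece_mult[OF assms S_piece_single]) simp
  then show ?case
    by (auto simp: hcomp_S_piece hcomp_S_piece[OF S_piece_single[OF refl]])
qed (auto simp: hcomp_add algebra_simps)

section \<open>Ideals of the polynomial ring in terms of its type class operations\<close>

lemma type_ring_carrier [simp]: "carrier (ring_of_type_algebra :: 'a::comm_ring_1 ring) = UNIV"
  and type_ring_mult [simp]: "x \<otimes>\<^bsub>ring_of_type_algebra\<^esub> y = x * y"
  and type_ring_add [simp]: "x \<oplus>\<^bsub>ring_of_type_algebra\<^esub> y = x + y"
  and type_ring_zero [simp]: "\<zero>\<^bsub>ring_of_type_algebra\<^esub> = (0 :: 'a)"
  and type_ring_one [simp]: "\<one>\<^bsub>ring_of_type_algebra\<^esub> = (1 :: 'a)"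
  for x y :: "'a::comm_ring_1"
  by (simp_all add: ring_of_type_algebra_def)

text \<open>Negatives come from multiplication by \<open>- 1\<close> and two-sidedness from
  commutativity, so the axioms of the ring record shrink to three closure conditions.\<close>

lemma ideal_S_iff:
  fixes I :: "('n::finite, 'k::field_char_0) mvpoly set"
  shows "ideal I S_ring \<longleftrightarrow> 0 \<in> I \<and> (\<forall>a\<in>I. \<forall>b\<in>I. a + b \<in> I) \<and> (\<forall>a\<in>I. \<forall>r. r * a \<in> I)"
proof
  assume "ideal I S_ring"
  then interpret ideal I "S_ring :: ('n, 'k) mvpoly ring" .
  show "0 \<in> I \<and> (\<forall>a\<in>I. \<forall>b\<in>I. a + b \<in> I) \<and> (\<forall>a\<in>I. \<forall>r. r * a \<in> I)"
    using additive_subgroup.zero_closed[OF additive_subgroup_axioms]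
      additive_subgroup.a_closed[OF additive_subgroup_axioms] I_l_closed by simp
next
  assume I: "0 \<in> I \<and> (\<forall>a\<in>I. \<forall>b\<in>I. a + b \<in> I) \<and> (\<forall>a\<in>I. \<forall>r. r * a \<in> I)"
  interpret S: cring "S_ring :: ('n, 'k) mvpoly ring" ..
  have m: "- a \<in> I" if "a \<in> I" for a
    using I that mult_minus1[of a] by metis
  have "\<ominus>\<^bsub>S_ring\<^esub> a = - a" for a :: "('n, 'k) mvpoly"
    by (rule S.minus_equality) auto
  with I m have "subgroup I (add_monoid S_ring)"
    by (intro S.add.subgroupI) (auto simp: a_inv_def)
  with I show "ideal I S_ring"
    by (intro idealI S.ring_axioms) (auto simp: mult.commute)
qed

lemma ideal_0: "ideal I S_ring \<Longrightarrow> 0 \<in> I"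
  and ideal_add: "ideal I S_ring \<Longrightarrow> a \<in> I \<Longrightarrow> b \<in> I \<Longrightarrow> a + b \<in> I"
  and ideal_mult: "ideal I S_ring \<Longrightarrow> a \<in> I \<Longrightarrow> r * a \<in> I"
  for I :: "('n::finite, 'k::field_char_0) mvpoly set"
  by (simp_all add: ideal_S_iff)

lemma ideal_uminus: "ideal I S_ring \<Longrightarrow> a \<in> I \<Longrightarrow> - a \<in> I"
  for I :: "('n::finite, 'k::field_char_0) mvpoly set"
  using ideal_mult[of I a "- 1"] by simp

lemma ideal_diff: "ideal I S_ring \<Longrightarrow> a \<in> I \<Longrightarrow> b \<in> I \<Longrightarrow> a - b \<in> I"
  for I :: "('n::finite, 'k::field_char_0) mvpoly set"
  using ideal_add[of I a "- b"] ideal_uminus[of I b] by simp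

lemma ideal_sum: "ideal I S_ring \<Longrightarrow> (\<And>x. x \<in> A \<Longrightarrow> f x \<in> I) \<Longrightarrow> sum f A \<in> I"
  for I :: "('n::finite, 'k::field_char_0) mvpoly set"
  by (induction A rule: infinite_finite_induct) (auto intro: ideal_add ideal_0)

lemma keys_subset_ideal:
  fixes I :: "('n::finite, 'k::field_char_0) mvpoly set"
  assumes "ideal I S_ring" "\<And>m. m \<in> Poly_Mapping.keys p \<Longrightarrow> monomial m \<in> I"
  shows "p \<in> I"
proof -
  have "p = (\<Sum>m\<in>Poly_Mapping.keys p. const (Poly_Mapping.lookup p m) * monomial m)"
    unfolding single_eq_const_mult[symmetric]
    by (rule poly_mapping_eqI) (auto simp: lookup_sum lookup_single when_def in_keys_iff)
  also have "\<dots> \<in> I"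
    by (intro ideal_sum ideal_mult assms)
  finally show ?thesis .
qed

lemma S_piece_subset_ideal:
  fixes I :: "('n::finite, 'k::field_char_0) mvpoly set"
  assumes "ideal I S_ring" "\<And>m. mon_deg m = j \<Longrightarrow> monomial m \<in> I"
  shows "S_piece j \<subseteq> I"
  using keys_subset_ideal[OF assms(1)] assms(2) by (auto simp: S_piece_def)

section \<open>The quotient algebra and its Hilbert function\<close>

lemma cls_eq_iff:
  fixes I :: "('n::finite, 'k::field_char_0) mvpoly set"
  assumes "ideal I S_ring"
  shows "cls I p = cls I q \<longleftrightarrow> p - q \<in> I"
proof -
  have cls: "cls I p = {a + p |a. a \<in> I}" for p
    by (auto simp: cls_def a_r_coset_def r_coset_def)
  show ?thesis
  proof
    assume "cls I p = cls I q"
    then have "0 + p \<in> {a + q |a. a \<in> I}"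
      unfolding cls using ideal_0[OF assms] by blast
    then show "p - q \<in> I" by auto
  next
    assume *: "p - q \<in> I"
    have "a + p = (a + (p - q)) + q" "a + q = (a - (p - q)) + p" for a
      by simp_all
    then show "cls I p = cls I q"
      unfolding cls using ideal_add[OF assms _ *] ideal_diff[OF assms _ *] by blast
  qed
qed

lemma cls_hom:
  fixes I :: "('n::finite, 'k::field_char_0) mvpoly set"
  assumes "ideal I S_ring"
  shows "ring_hom_ring S_ring (R_ring I) (cls I)"
  using ideal.rcos_ring_hom_ring[OF assms] unfolding cls_def .

lemma cls_mult:
  fixes I :: "('n::finite, 'k::field_char_0) mvpoly set"
  assumes "ideal I S_ring"
  shows "cls I p \<otimes>\<^bsub>R_ring I\<^esub> cls I q = cls I (p * q)"
  using ring_hom_mult[OF ring_hom_ring.homh[OF cls_hom[OF assms]], of p q] by simp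

lemma cls_add:
  fixes I :: "('n::finite, 'k::field_char_0) mvpoly set"
  assumes "ideal I S_ring"
  shows "cls I p \<oplus>\<^bsub>R_ring I\<^esub> cls I q = cls I (p + q)"
  using ring_hom_add[OF ring_hom_ring.homh[OF cls_hom[OF assms]], of p q] by simp

lemma mult_map_cls: "ideal I S_ring \<Longrightarrow> mult_map I f (cls I p) = cls I (f * p)"
  by (simp add: mult_map_def cls_mult)

text \<open>Since \<open>f\<close> is homogeneous of degree \<open>i\<close>, the image always lies
  in \<open>R_piece I (j + i)\<close>. The equality of sets in \<open>mult_surj\<close> thus reduces
  to one inclusion, which is a family of congruences modulo \<open>I\<close>.\<close>

lemma mult_surj_iff:
  fixes I :: "('n::finite, 'k::field_char_0) mvpoly set"
  assumes "ideal I S_ring" "f \<in> S_piece i"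
  shows "mult_surj I f j (j + i) \<longleftrightarrow> (\<forall>q\<in>S_piece (j + i). \<exists>p\<in>S_piece j. q - f * p \<in> I)"
proof -
  have "f * p \<in> S_piece (j + i)" if "p \<in> S_piece j" for p
    using S_piece_mult[OF assms(2) that] by (simp add: add.commute)
  moreover have "mult_map I f ` R_piece I j = (\<lambda>p. cls I (f * p)) ` S_piece j"
    by (simp add: R_piece_def image_image mult_map_cls[OF assms(1)])
  ultimately have "mult_surj I f j (j + i) \<longleftrightarrow>
      cls I ` S_piece (j + i) \<subseteq> (\<lambda>p. cls I (f * p)) ` S_piece j"
    unfolding mult_surj_def R_piece_def by auto
  then show ?thesis
    by (simp add: image_subset_iff image_iff cls_eq_iff[OF assms(1)])
qed

lemma mult_inj_iff:
  fixes I :: "('n::finite, 'k::field_char_0) mvpoly set"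
  assumes "ideal I S_ring"
  shows "mult_inj I f j \<longleftrightarrow> (\<forall>p\<in>S_piece j. f * p \<in> I \<longrightarrow> p \<in> I)"
proof
  assume inj: "mult_inj I f j"
  show "\<forall>p\<in>S_piece j. f * p \<in> I \<longrightarrow> p \<in> I"
  proof (intro ballI impI)
    fix p assume p: "p \<in> S_piece j" "f * p \<in> I"
    then have "mult_map I f (cls I p) = mult_map I f (cls I 0)"
      using assms by (simp add: mult_map_cls cls_eq_iff)
    then have "cls I p = cls I 0"
      using inj p unfolding mult_inj_def R_piece_def by (blast dest: inj_onD intro: S_piece_0)
    then show "p \<in> I" using assms by (simp add: cls_eq_iff)
  qed
next
  assume *: "\<forall>p\<in>S_piece j. f * p \<in> I \<longrightarrow> p \<in> I"
  show "mult_inj I f j"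
    unfolding mult_inj_def R_piece_def
  proof (rule inj_onI, clarify)
    fix p q assume p: "p \<in> S_piece j" "q \<in> S_piece j"
      and "mult_map I f (cls I p) = mult_map I f (cls I q)"
    then have "f * (p - q) \<in> I"
      using assms by (simp add: mult_map_cls cls_eq_iff algebra_simps)
    with * p have "p - q \<in> I" by (blast intro: S_piece_diff)
    then show "cls I p = cls I q" using assms by (simp add: cls_eq_iff)
  qed
qed

text \<open>For \<open>I = UNIV\<close> the scalars are not a field, and dimensions over them are junk values.\<close>

lemma subfield_scalars:
  fixes I :: "('n::finite, 'k::field_char_0) mvpoly set"
  assumes I: "ideal I S_ring" and "1 \<notin> I"
  shows "subfield (scalars I) (R_ring I)"
proof -
  interpret h: ring_hom_ring S_ring "R_ring I" "cls I" by (rule cls_hom[OF I])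
  interpret K: field "ring_of_type_algebra :: 'k ring" by (rule field_from_type_algebra)
  have "(\<lambda>c. cls I (const c)) \<in> ring_hom (ring_of_type_algebra :: 'k ring) (R_ring I)"
    using h.hom_one
    by (intro ring_hom_memI)
       (auto simp: cls_mult[OF I] cls_add[OF I] mult_single single_add)
  then interpret g: ring_hom_ring "ring_of_type_algebra :: 'k ring" "R_ring I" "\<lambda>c. cls I (const c)"
    by (intro ring_hom_ringI2 K.ring_axioms h.S.ring_axioms)
  have "\<one>\<^bsub>R_ring I\<^esub> \<noteq> \<zero>\<^bsub>R_ring I\<^esub>"
    using assms h.hom_zero h.hom_one cls_eq_iff[OF I, of 1 0] by auto
  from g.img_is_subfield(2)[OF K.carrier_is_subfield this] show ?thesis
    by (simp add: scalars_def)
qed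

text \<open>The recursion mirrors that of \<open>Span\<close>, which adjoins one generator at a
  time. The last clause is the base case and also cuts off surplus entries when the lengths
  differ.\<close>

fun lincomb :: "'k::field_char_0 list \<Rightarrow> ('n::finite, 'k) mvpoly list \<Rightarrow> ('n, 'k) mvpoly" where
  "lincomb (c # cs) (q # qs) = const c * q + lincomb cs qs"
| "lincomb _ _ = 0"

lemma Span_cls:
  fixes I :: "('n::finite, 'k::field_char_0) mvpoly set"
  assumes I: "ideal I S_ring"
  shows "ring.Span (R_ring I) (scalars I) (map (cls I) qs) =
    {cls I (lincomb cs qs) |cs. length cs = length qs}"
proof -
  interpret h: ring_hom_ring S_ring "R_ring I" "cls I" by (rule cls_hom[OF I])
  show ?thesis
  proof (induction qs)
    case Nil
    then show ?case using h.hom_zero by (auto simp: h.S.Span.simps)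
  next
    case (Cons q qs)
    have "h.S.Span (scalars I) (map (cls I) (q # qs)) =
      h.S.line_extension (scalars I) (cls I q) (h.S.Span (scalars I) (map (cls I) qs))"
      by simp
    also have "\<dots> = {cls I (const c * q + lincomb cs qs) |c cs. length cs = length qs}"
      unfolding Cons.IH
      by (auto simp: h.S.line_extension_mem_iff scalars_def cls_mult[OF I] cls_add[OF I] Bex_def
          simp flip: cls_add[OF I]) blast+
    also have "\<dots> = {cls I (lincomb cs (q # qs)) |cs. length cs = length (q # qs)}"
    proof (intro equalityI subsetI)
      fix x assume "x \<in> {cls I (const c * q + lincomb cs qs) |c cs. length cs = length qs}"
      then obtain c cs where "x = cls I (lincomb (c # cs) (q # qs))" "length cs = length qs" by auto
      then show "x \<in> {cls I (lincomb cs (q # qs)) |cs. length cs = length (q # qs)}"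
        by (metis (mono_tags, lifting) length_Cons mem_Collect_eq)
    next
      fix x assume "x \<in> {cls I (lincomb cs (q # qs)) |cs. length cs = length (q # qs)}"
      then show "x \<in> {cls I (const c * q + lincomb cs qs) |c cs. length cs = length qs}"
        by (force simp: length_Suc_conv)
    qed
    finally show ?case .
  qed
qed

section \<open>Exponent vectors of given degree and bases of the graded pieces\<close>

lemma lookup_pos_decomp:
  fixes m :: "'n::finite \<Rightarrow>\<^sub>0 nat"
  assumes "Poly_Mapping.lookup m v > 0"
  obtains m' where "m = Poly_Mapping.single v 1 + m'"
proof
  show "m = Poly_Mapping.single v 1 + (m - Poly_Mapping.single v 1)"
    using assms by (auto intro!: poly_mapping_eqI simp: lookup_add lookup_minus lookup_single when_def)
qed

lemma mon_deg_Suc_decomp: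
  assumes "mon_deg m = Suc k"
  obtains v m' where "m = Poly_Mapping.single v 1 + m'" "mon_deg m' = k"
proof -
  from assms obtain v where "Poly_Mapping.lookup m v > 0"
    unfolding mon_deg_def by (metis gr0I nat.distinct(1) sum.neutral)
  then obtain m' where "m = Poly_Mapping.single v 1 + m'" by (rule lookup_pos_decomp)
  with assms show ?thesis by (intro that) auto
qed

lemma finite_mon_deg: "finite {m :: 'n::finite \<Rightarrow>\<^sub>0 nat. mon_deg m = k}"
proof (induction k)
  case (Suc k)
  have "{m :: 'n \<Rightarrow>\<^sub>0 nat. mon_deg m = Suc k} \<subseteq>
    (\<Union>v. (+) (Poly_Mapping.single v 1) ` {m. mon_deg m = k})"
  proof
    fix m :: "'n \<Rightarrow>\<^sub>0 nat" assume "m \<in> {m. mon_deg m = Suc k}"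
    then show "m \<in> (\<Union>v. (+) (Poly_Mapping.single v 1) ` {m. mon_deg m = k})"
      using mon_deg_Suc_decomp[of m k] by blast
  qed
  then show ?case by (rule finite_subset) (simp add: Suc)
qed simp

lemma finite_mon_deg_le: "finite {m :: 'n::finite \<Rightarrow>\<^sub>0 nat. mon_deg m \<le> k}"
proof -
  have "{m :: 'n \<Rightarrow>\<^sub>0 nat. mon_deg m \<le> k} = (\<Union>j\<le>k. {m. mon_deg m = j})" by auto
  then show ?thesis by (simp add: finite_mon_deg)
qed

lemma mon_deg_ge_decomp:
  assumes "k \<le> mon_deg m"
  obtains a b where "m = a + b" "mon_deg b = k"
proof -
  have "\<exists>a b. m = a + b \<and> mon_deg b = k" if "mon_deg m = j + k" for j
    using that
  proof (induction j arbitrary: m)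
    case 0
    then show ?case by (intro exI[of _ 0] exI[of _ m]) auto
  next
    case (Suc j)
    then obtain v m' where m: "m = Poly_Mapping.single v 1 + m'" "mon_deg m' = j + k"
      using mon_deg_Suc_decomp[of m "j + k"] by auto
    then obtain a b where "m' = a + b" "mon_deg b = k" using Suc.IH by blast
    with m show ?case
      by (intro exI[of _ "Poly_Mapping.single v 1 + a"] exI[of _ b]) (auto simp: add.assoc)
  qed
  from this[of "mon_deg m - k"] assms that show ?thesis by auto
qed

lemma cls_list_carrier:
  "set (map (cls I) qs) \<subseteq> carrier (R_ring I)"
  for I :: "('n::finite, 'k::field_char_0) mvpoly set"
  by (auto simp: FactRing_def A_RCOSETS_def' cls_def)

lemma lincomb_monomials:
  fixes xs :: "('n::finite \<Rightarrow>\<^sub>0 nat) list"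
  assumes "distinct xs"
  shows "{lincomb cs (map monomial xs) |cs. length cs = length xs} =
    {p :: ('n, 'k::field_char_0) mvpoly. Poly_Mapping.keys p \<subseteq> set xs}"
proof -
  have keys: "Poly_Mapping.keys (lincomb cs (map monomial xs) :: ('n, 'k) mvpoly) \<subseteq> set xs" for cs
  proof (induction xs arbitrary: cs)
    case (Cons x xs)
    show ?case
    proof (cases cs)
      case (Cons c cs')
      have "lincomb cs (map monomial (x # xs)) =
        Poly_Mapping.single x c + (lincomb cs' (map monomial xs) :: ('n, 'k) mvpoly)"
        by (simp add: Cons single_eq_const_mult[of x])
      also have "Poly_Mapping.keys \<dots> \<subseteq> {x} \<union> set xs"
        by (rule order.trans[OF keys_add]) (use Cons.IH[of cs'] in auto)
      finally show ?thesis by simp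
    qed simp
  qed simp
  have "lincomb (map (Poly_Mapping.lookup p) xs) (map monomial xs) = p"
    if "distinct xs" "Poly_Mapping.keys p \<subseteq> set xs" for p :: "('n, 'k) mvpoly"
  proof -
    have "lincomb (map (Poly_Mapping.lookup p) xs) (map monomial xs) =
      (\<Sum>m\<in>set xs. Poly_Mapping.single m (Poly_Mapping.lookup p m))"
      using that(1) by (induction xs) (auto simp: single_eq_const_mult[symmetric])
    also have "\<dots> = p"
      using that(2)
      by (intro poly_mapping_eqI) (auto simp: lookup_sum lookup_single when_def in_keys_iff)
    finally show ?thesis .
  qed
  then have "\<exists>cs. p = lincomb cs (map monomial xs) \<and> length cs = length xs"
    if "Poly_Mapping.keys p \<subseteq> set xs" for p :: "('n, 'k) mvpoly"
    using that assms by (intro exI[of _ "map (Poly_Mapping.lookup p) xs"]) auto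
  then show ?thesis using keys by auto
qed

lemma Span_monomials:
  fixes I :: "('n::finite, 'k::field_char_0) mvpoly set"
  assumes "ideal I S_ring" "distinct xs"
  shows "ring.Span (R_ring I) (scalars I) (map (cls I) (map monomial xs)) =
    cls I ` {p. Poly_Mapping.keys p \<subseteq> set xs}"
  unfolding Span_cls[OF assms(1)] lincomb_monomials[OF assms(2), symmetric] by auto

text \<open>A basis of \<open>R_piece I d\<close> has \<open>HF I d\<close> elements, each the class
  of a form of degree \<open>d\<close>; lifting these forms gives \<open>qs\<close>. Properness of
  \<open>I\<close> makes \<open>scalars I\<close> a field, so that \<open>HF\<close> is a genuine
  dimension.\<close>

lemma R_piece_spanning:
  fixes I :: "('n::finite, 'k::field_char_0) mvpoly set"
  assumes I: "ideal I S_ring" and "1 \<notin> I"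
  obtains qs where "length qs = HF I d" "set qs \<subseteq> S_piece d"
    "\<And>p. p \<in> S_piece d \<Longrightarrow> \<exists>cs. length cs = length qs \<and> p - lincomb cs qs \<in> I"
proof -
  interpret h: ring_hom_ring S_ring "R_ring I" "cls I" by (rule cls_hom[OF I])
  note K = subfield_scalars[OF assms]
  obtain xs where xs: "set xs = {m :: 'n \<Rightarrow>\<^sub>0 nat. mon_deg m = d}" "distinct xs"
    using finite_distinct_list[OF finite_mon_deg] by blast
  have "h.S.Span (scalars I) (map (cls I) (map monomial xs)) = R_piece I d"
    unfolding Span_monomials[OF I xs(2)] xs(1) R_piece_def S_piece_def by auto
  then have "h.S.finite_dimension (scalars I) (R_piece I d)"
    using h.S.Span_finite_dimension[OF K cls_list_carrier, of "map monomial xs"] by metis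
  then have "h.S.dimension (HF I d) (scalars I) (R_piece I d)"
    using h.S.finite_dimensionE[OF K] by (simp add: HF_def over_def)
  then obtain Vs where Vs: "h.S.independent (scalars I) Vs"
    "length Vs = HF I d" "h.S.Span (scalars I) Vs = R_piece I d"
    using h.S.exists_base[OF K] by blast
  have "set Vs \<subseteq> cls I ` S_piece d"
    using h.S.Span_base_incl[OF K h.S.independent_in_carrier[OF Vs(1)]]
    unfolding Vs(3) R_piece_def .
  then have "Vs \<in> map (cls I) ` lists (S_piece d)"
    unfolding lists_image[symmetric] by auto
  then obtain qs where qs: "Vs = map (cls I) qs" "set qs \<subseteq> S_piece d" by auto
  show ?thesis
  proof (rule that[of qs])
    fix p :: "('n, 'k) mvpoly" assume "p \<in> S_piece d"
    then have "cls I p \<in> {cls I (lincomb cs qs) |cs. length cs = length qs}"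
      unfolding Span_cls[OF I, symmetric] using Vs qs by (simp add: R_piece_def)
    then show "\<exists>cs. length cs = length qs \<and> p - lincomb cs qs \<in> I"
      using cls_eq_iff[OF I] by blast
  qed (use Vs qs in auto)
qed

text \<open>The monomials of degree \<open>d\<close> with exponent outside \<open>U\<close>
  represent a basis: terms with exponent in \<open>U\<close> vanish modulo \<open>I\<close>, and no
  nonzero combination of the others lies in \<open>I\<close>.\<close>

lemma HF_monomial_ideal:
  fixes I :: "('n::finite, 'k::field_char_0) mvpoly set"
  assumes I: "ideal I S_ring" and "1 \<notin> I" and U: "I = {p. Poly_Mapping.keys p \<subseteq> U}"
  shows "HF I d = card ({m. mon_deg m = d} - U)"
proof -
  interpret h: ring_hom_ring S_ring "R_ring I" "cls I" by (rule cls_hom[OF I])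
  note K = subfield_scalars[OF assms(1,2)]
  obtain xs where xs: "set xs = {m :: 'n \<Rightarrow>\<^sub>0 nat. mon_deg m = d} - U" "distinct xs"
    using finite_distinct_list[OF finite_Diff[OF finite_mon_deg]] by blast
  have ind: "h.S.independent (scalars I) (map (cls I) (map monomial ys))"
    if "distinct ys" "set ys \<inter> U = {}" for ys
    using that
  proof (induction ys)
    case (Cons y ys)
    \<comment> \<open>If \<open>monomial y\<close> were congruent to such a \<open>p\<close>, the
      difference would lie in \<open>I\<close> and still contain the exponent \<open>y\<close>,
      which is not in \<open>U\<close>.\<close>
    have "cls I (monomial y) \<notin> cls I ` {p. Poly_Mapping.keys p \<subseteq> set ys}"
    proof
      assume "cls I (monomial y) \<in> cls I ` {p. Poly_Mapping.keys p \<subseteq> set ys}"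
      then obtain p where p: "Poly_Mapping.keys p \<subseteq> set ys" "monomial y - p \<in> I"
        by (auto simp: cls_eq_iff[OF I])
      then have "y \<in> Poly_Mapping.keys (monomial y - p)"
        using Cons.prems
        by (metis (no_types, lifting) diff_zero distinct.simps(2) in_keys_iff lookup_minus
            lookup_single_eq monomial_def one_neq_zero subsetD)
      with p(2) Cons.prems show False unfolding U by auto
    qed
    then show ?case
      using Cons Span_monomials[OF I, of ys] by (auto intro!: h.S.independent.intros(2))
  qed simp
  have "h.S.Span (scalars I) (map (cls I) (map monomial xs)) = R_piece I d"
    unfolding Span_monomials[OF I xs(2)] R_piece_def
  proof (intro equalityI subsetI)
    fix x assume "x \<in> cls I ` {p. Poly_Mapping.keys p \<subseteq> set xs}"
    then show "x \<in> cls I ` S_piece d" using xs by (auto simp: S_piece_def)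
  next
    fix x assume "x \<in> cls I ` S_piece d"
    then obtain p where p: "x = cls I p" "p \<in> S_piece d" by auto
    define q where "q = (\<Sum>m\<in>Poly_Mapping.keys p - U. Poly_Mapping.single m (Poly_Mapping.lookup p m))"
    have q: "Poly_Mapping.lookup q m = (if m \<in> U then 0 else Poly_Mapping.lookup p m)" for m
      by (auto simp: q_def lookup_sum lookup_single when_def in_keys_iff)
    have "p - q \<in> I" unfolding U by (auto simp: in_keys_iff lookup_minus q split: if_splits)
    moreover have "Poly_Mapping.keys q \<subseteq> set xs"
      using p(2) by (auto simp: in_keys_iff q xs S_piece_def split: if_splits)
    ultimately show "x \<in> cls I ` {p. Poly_Mapping.keys p \<subseteq> set xs}"
      unfolding p(1) using cls_eq_iff[OF I] by auto
  qed
  moreover have "h.S.independent (scalars I) (map (cls I) (map monomial xs))"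
    using xs by (intro ind) auto
  ultimately have "h.S.dimension (length xs) (scalars I) (R_piece I d)"
    using h.S.dimensionI[OF K, of "map (cls I) (map monomial xs)" "R_piece I d"]
    by (metis length_map)
  then have "HF I d = length xs"
    using h.S.dimI[OF K] by (simp add: HF_def over_def)
  then show ?thesis using xs distinct_card by metis
qed

section \<open>Generated ideals and the three classes\<close>

lemma ideal_keys_upset:
  fixes U :: "('n::finite \<Rightarrow>\<^sub>0 nat) set"
  assumes "\<And>a b. b \<in> U \<Longrightarrow> a + b \<in> U"
  shows "ideal {p :: ('n, 'k::field_char_0) mvpoly. Poly_Mapping.keys p \<subseteq> U} S_ring"
  unfolding ideal_S_iff
proof (intro conjI ballI allI)
  fix a b assume "a \<in> {p :: ('n, 'k) mvpoly. Poly_Mapping.keys p \<subseteq> U}"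
    "b \<in> {p :: ('n, 'k) mvpoly. Poly_Mapping.keys p \<subseteq> U}"
  then show "a + b \<in> {p :: ('n, 'k) mvpoly. Poly_Mapping.keys p \<subseteq> U}"
    using keys_add[of a b] by blast
next
  fix a r assume "a \<in> {p :: ('n, 'k) mvpoly. Poly_Mapping.keys p \<subseteq> U}"
  then show "r * a \<in> {p :: ('n, 'k) mvpoly. Poly_Mapping.keys p \<subseteq> U}"
    using keys_mult[of r a] assms by blast
qed simp

lemma Idl_is_ideal: "ideal (Idl\<^bsub>S_ring\<^esub> F) (S_ring :: ('n::finite, 'k::field_char_0) mvpoly ring)"
  by (rule ring.genideal_ideal[OF ring_from_type_algebra]) simp

lemma Idl_subset:
  fixes J :: "('n::finite, 'k::field_char_0) mvpoly set"
  shows "ideal J S_ring \<Longrightarrow> F \<subseteq> J \<Longrightarrow> Idl\<^bsub>S_ring\<^esub> F \<subseteq> J"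
  by (rule ring.genideal_minimal[OF ring_from_type_algebra])

lemma Idl_incl: "F \<subseteq> Idl\<^bsub>S_ring\<^esub> (F :: ('n::finite, 'k::field_char_0) mvpoly set)"
  by (rule ring.genideal_self[OF ring_from_type_algebra]) simp

lemma Idl_monomials:
  fixes M :: "('n::finite \<Rightarrow>\<^sub>0 nat) set"
  shows "Idl\<^bsub>S_ring\<^esub> (monomial ` M) =
    {p :: ('n, 'k::field_char_0) mvpoly. Poly_Mapping.keys p \<subseteq> {a + b |a b. b \<in> M}}"
proof
  have up: "a + m \<in> {a + b |a b. b \<in> M}" if m: "m \<in> {a + b |a b. b \<in> M}" for a m
  proof -
    from m obtain c e where ce: "m = c + e" "e \<in> M" by blast
    then have "a + m = (a + c) + e" by (simp add: add.assoc)
    with ce show ?thesis by blast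
  qed
  have "monomial ` M \<subseteq> {p :: ('n, 'k) mvpoly. Poly_Mapping.keys p \<subseteq> {a + b |a b. b \<in> M}}"
    by (auto simp: monomial_def intro: exI[of _ 0])
  then show "Idl\<^bsub>S_ring\<^esub> (monomial ` M) \<subseteq>
    {p :: ('n, 'k) mvpoly. Poly_Mapping.keys p \<subseteq> {a + b |a b. b \<in> M}}"
    using Idl_subset[OF ideal_keys_upset[OF up]] by blast
  show "{p :: ('n, 'k) mvpoly. Poly_Mapping.keys p \<subseteq> {a + b |a b. b \<in> M}} \<subseteq> Idl\<^bsub>S_ring\<^esub> (monomial ` M)"
  proof clarify
    fix p :: "('n, 'k) mvpoly"
    assume p: "Poly_Mapping.keys p \<subseteq> {a + b |a b. b \<in> M}"
    show "p \<in> Idl\<^bsub>S_ring\<^esub> (monomial ` M)"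
    proof (rule keys_subset_ideal[OF Idl_is_ideal])
      fix m assume "m \<in> Poly_Mapping.keys p"
      then obtain a b where "m = a + b" "b \<in> M" using p by blast
      then show "monomial m \<in> Idl\<^bsub>S_ring\<^esub> (monomial ` M :: ('n, 'k) mvpoly set)"
        using Idl_incl[of "monomial ` M"] by (auto simp: monomial_add intro!: ideal_mult[OF Idl_is_ideal])
    qed
  qed
qed

definition homogeneous_set :: "('n::finite, 'k::field_char_0) mvpoly set \<Rightarrow> bool" where
  "homogeneous_set I \<longleftrightarrow> (\<forall>p\<in>I. \<forall>j. hcomp j p \<in> I)"

text \<open>The polynomials all of whose components lie in the generated ideal form an ideal
  \<open>J\<close> themselves. It contains the homogeneous generators and hence everything they
  generate.\<close>

lemma homogeneous_Idl:
  fixes F :: "('n::finite, 'k::field_char_0) mvpoly set"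
  assumes "\<And>f. f \<in> F \<Longrightarrow> \<exists>e. f \<in> S_piece e"
  shows "homogeneous_set (Idl\<^bsub>S_ring\<^esub> F)"
proof -
  note I = Idl_is_ideal[of F]
  define J where "J = {p. \<forall>j. hcomp j p \<in> Idl\<^bsub>S_ring\<^esub> F}"
  have "r * a \<in> J" if "a \<in> J" for r a
  proof (induction r rule: mvpoly_induct)
    case (single m c)
    show ?case using that ideal_0[OF I]
      by (auto simp: J_def hcomp_mult[OF S_piece_single[OF refl]] intro: ideal_mult[OF I])
  qed (use ideal_0[OF I] in \<open>auto simp: J_def hcomp_add distrib_right intro: ideal_add[OF I]\<close>)
  then have "ideal J S_ring"
    unfolding ideal_S_iff using ideal_0[OF I] ideal_add[OF I] by (auto simp: J_def hcomp_add)
  moreover have "F \<subseteq> J"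
  proof
    fix f assume "f \<in> F"
    moreover from this obtain e where "f \<in> S_piece e" using assms by blast
    ultimately show "f \<in> J"
      using Idl_incl[of F] ideal_0[OF I] by (auto simp: J_def hcomp_S_piece)
  qed
  ultimately have "Idl\<^bsub>S_ring\<^esub> F \<subseteq> J" by (rule Idl_subset)
  then show ?thesis by (auto simp: J_def homogeneous_set_def)
qed

lemma Idl_min_degree:
  fixes F :: "('n::finite, 'k::field_char_0) mvpoly set"
  assumes "\<And>f m. f \<in> F \<Longrightarrow> m \<in> Poly_Mapping.keys f \<Longrightarrow> d \<le> mon_deg m"
    and "p \<in> Idl\<^bsub>S_ring\<^esub> F" "m \<in> Poly_Mapping.keys p"
  shows "d \<le> mon_deg m"
proof -
  have "Idl\<^bsub>S_ring\<^esub> F \<subseteq> {p. Poly_Mapping.keys p \<subseteq> {m. d \<le> mon_deg m}}"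
    by (rule Idl_subset[OF ideal_keys_upset]) (use assms(1) in auto)
  with assms(2,3) show ?thesis by blast
qed

text \<open>Collects what the lower bounds use about the three classes in common: finite dimension,
  homogeneity and the absence of terms of degree below \<open>d\<close>.\<close>

lemma ideal_classes:
  fixes I :: "('n::finite, 'k::field_char_0) mvpoly set"
  assumes "I \<in> artinian_gen_in_degree d \<union> artinian_monomial d \<union> artinian_homogeneous d"
  shows "artinian I" "ideal I S_ring" "homogeneous_set I"
    "p \<in> I \<Longrightarrow> m \<in> Poly_Mapping.keys p \<Longrightarrow> d \<le> mon_deg m"
proof -
  show "artinian I"
    using assms by (auto simp: artinian_gen_in_degree_def artinian_monomial_def artinian_homogeneous_def)
  then show "ideal I S_ring" by (simp add: artinian_def)
  have "\<exists>F. I = Idl\<^bsub>S_ring\<^esub> F \<and> (\<forall>f\<in>F. (\<exists>e. f \<in> S_piece e) \<and> (\<forall>m\<in>Poly_Mapping.keys f. d \<le> mon_deg m))"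
    using assms
  proof (elim UnE)
    assume "I \<in> artinian_gen_in_degree d"
    then obtain F where "F \<subseteq> S_piece d" "I = Idl\<^bsub>S_ring\<^esub> F"
      unfolding artinian_gen_in_degree_def by blast
    then show ?thesis by (intro exI[of _ F]) (auto simp: S_piece_def)
  next
    assume "I \<in> artinian_monomial d"
    then obtain M where M: "finite M" "Min (mon_deg ` M) = d" "I = Idl\<^bsub>S_ring\<^esub> (monomial ` M)"
      unfolding artinian_monomial_def by blast
    then have "d \<le> mon_deg m" if "m \<in> M" for m using that Min_le[of "mon_deg ` M"] by blast
    with M(3) show ?thesis
      by (intro exI[of _ "monomial ` M"]) (auto simp: S_piece_def monomial_def)
  next
    assume "I \<in> artinian_homogeneous d"
    then obtain F where F: "finite F" "\<forall>f\<in>F. f \<noteq> 0 \<and> (\<exists>e. f \<in> S_piece e)"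
      "Min (poly_deg ` F) = d" "I = Idl\<^bsub>S_ring\<^esub> F"
      unfolding artinian_homogeneous_def by blast
    have "d \<le> mon_deg m" if fm: "f \<in> F" "m \<in> Poly_Mapping.keys f" for f m
    proof -
      obtain e where e: "f \<in> S_piece e" using F fm by blast
      \<comment> \<open>A nonzero form has terms of one degree only, so the minimum of
        \<open>poly_deg\<close> over the generators bounds the degree of every term from
        below.\<close>
      then have "mon_deg ` Poly_Mapping.keys f = {e}" using fm by (auto simp: S_piece_def)
      then have "poly_deg f = e" by (simp add: poly_deg_def)
      then show ?thesis using e fm F(1,3) Min_le[of "poly_deg ` F" "poly_deg f"]
        by (auto simp: S_piece_def)
    qed
    with F show ?thesis by blast
  qed
  then obtain F where F: "I = Idl\<^bsub>S_ring\<^esub> F" "\<And>f. f \<in> F \<Longrightarrow> \<exists>e. f \<in> S_piece e"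
    "\<And>f m. f \<in> F \<Longrightarrow> m \<in> Poly_Mapping.keys f \<Longrightarrow> d \<le> mon_deg m" by blast
  show "homogeneous_set I" unfolding F(1) by (rule homogeneous_Idl[OF F(2)])
  show "p \<in> I \<Longrightarrow> m \<in> Poly_Mapping.keys p \<Longrightarrow> d \<le> mon_deg m"
    unfolding F(1) using F(3) by (rule Idl_min_degree)
qed

text \<open>Finitely many representatives \<open>qs\<close> span the quotient; let \<open>N\<close>
  exceed the degrees of all their terms. A monomial of degree \<open>j\<close> with
  \<open>N \<le> j\<close> is congruent to a combination of them, and the component of degree
  \<open>j\<close> of this congruence puts the monomial itself into \<open>I\<close>.\<close>

lemma artinian_vanishes:
  fixes I :: "('n::finite, 'k::field_char_0) mvpoly set"
  assumes "artinian I" "1 \<notin> I" "homogeneous_set I"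
  obtains N where "\<And>j. N \<le> j \<Longrightarrow> S_piece j \<subseteq> I"
proof -
  have I: "ideal I S_ring" using assms by (simp add: artinian_def)
  interpret h: ring_hom_ring S_ring "R_ring I" "cls I" by (rule cls_hom[OF I])
  note K = subfield_scalars[OF I assms(2)]
  obtain n where "h.S.dimension n (scalars I) (carrier (R_ring I))"
    using assms by (auto simp: artinian_def h.S.finite_dimension_def)
  then obtain Vs where Vs: "set Vs \<subseteq> carrier (R_ring I)" "h.S.Span (scalars I) Vs = carrier (R_ring I)"
    using h.S.exists_base[OF K] by blast
  have "carrier (R_ring I) = cls I ` UNIV"
    by (auto simp: FactRing_def A_RCOSETS_def' cls_def)
  with Vs(1) obtain qs where qs: "Vs = map (cls I) qs"
    by (metis ex_map_conv image_iff subset_iff)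
  obtain N where N: "\<And>q m. q \<in> set qs \<Longrightarrow> m \<in> Poly_Mapping.keys q \<Longrightarrow> mon_deg m < N"
  proof -
    have "finite (mon_deg ` (\<Union>q\<in>set qs. Poly_Mapping.keys q))" by simp
    then obtain N where "\<forall>x\<in>mon_deg ` (\<Union>q\<in>set qs. Poly_Mapping.keys q). x < N"
      using finite_nat_set_iff_bounded by blast
    then show ?thesis by (intro that[of N]) auto
  qed
  show ?thesis
  proof (rule that[of N], rule S_piece_subset_ideal[OF I])
    fix j and m :: "'n \<Rightarrow>\<^sub>0 nat" assume j: "N \<le> j" "mon_deg m = j"
    have "cls I (monomial m) \<in> {cls I (lincomb cs qs) |cs. length cs = length qs}"
      unfolding Span_cls[OF I, symmetric] qs[symmetric] Vs(2) by simp
    then obtain cs where "monomial m - lincomb cs qs \<in> I"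
      using cls_eq_iff[OF I] by blast
    then have "hcomp j (monomial m - lincomb cs qs) \<in> I"
      using assms(3) by (simp add: homogeneous_set_def)
    moreover have "hcomp j (lincomb cs qs) = 0" if "\<And>q m. q \<in> set qs \<Longrightarrow> m \<in> Poly_Mapping.keys q \<Longrightarrow> mon_deg m < N"
      using that
    proof (induction cs qs rule: lincomb.induct)
      case (1 c cs q qs)
      have "hcomp j (const c * q) = 0"
        using 1(2)[of q] j by (intro poly_mapping_eqI) (force simp: lookup_hcomp when_def in_keys_iff)
      with 1(1) 1(2) show ?case unfolding lincomb.simps hcomp_add by (metis add_0 list.set_intros(2))
    qed auto
    moreover have "hcomp j (monomial m - lincomb cs qs) = monomial m - hcomp j (lincomb cs qs)"
      using j by (intro poly_mapping_eqI) (auto simp: lookup_hcomp lookup_minus monomial_def lookup_single when_def)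
    ultimately show "monomial m \<in> I" using N by simp
  qed
qed

text \<open>The monomials of degree at most \<open>N\<close> span the quotient, because all other
  terms of a polynomial lie in \<open>I\<close>.\<close>

lemma artinianI:
  fixes I :: "('n::finite, 'k::field_char_0) mvpoly set"
  assumes I: "ideal I S_ring" and "1 \<notin> I" and "\<And>m. N < mon_deg m \<Longrightarrow> monomial m \<in> I"
  shows "artinian I"
proof -
  interpret h: ring_hom_ring S_ring "R_ring I" "cls I" by (rule cls_hom[OF I])
  note K = subfield_scalars[OF assms(1,2)]
  obtain xs where xs: "set xs = {m :: 'n \<Rightarrow>\<^sub>0 nat. mon_deg m \<le> N}" "distinct xs"
    using finite_distinct_list[OF finite_mon_deg_le] by blast
  have "cls I p \<in> cls I ` {p. Poly_Mapping.keys p \<subseteq> set xs}" for p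
  proof -
    define q where "q = (\<Sum>m\<in>{m\<in>Poly_Mapping.keys p. mon_deg m \<le> N}. Poly_Mapping.single m (Poly_Mapping.lookup p m))"
    have q: "Poly_Mapping.lookup q m = (if mon_deg m \<le> N then Poly_Mapping.lookup p m else 0)" for m
      by (auto simp: q_def lookup_sum lookup_single when_def in_keys_iff)
    have "p - q \<in> I"
      by (rule keys_subset_ideal[OF I], rule assms(3)) (auto simp: in_keys_iff lookup_minus q split: if_splits)
    moreover have "Poly_Mapping.keys q \<subseteq> set xs"
      by (auto simp: in_keys_iff q xs split: if_splits)
    ultimately show ?thesis using cls_eq_iff[OF I] by auto
  qed
  moreover have "carrier (R_ring I) = cls I ` UNIV"
    by (auto simp: FactRing_def A_RCOSETS_def' cls_def)
  ultimately have "h.S.Span (scalars I) (map (cls I) (map monomial xs)) = carrier (R_ring I)"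
    unfolding Span_monomials[OF I xs(2)] by auto
  then show ?thesis
    using h.S.Span_finite_dimension[OF K cls_list_carrier, of "map monomial xs"] I
    by (metis artinian_def)
qed

section \<open>Substitution homomorphisms and separating weights\<close>

text \<open>Evaluation that sends coefficients through \<open>h\<close> and each variable
  \<open>v\<close> to \<open>g v\<close>. The target is always a univariate polynomial ring: over
  \<open>'k\<close> for the absence of zero divisors and for the sharpness example, over the
  polynomial ring \<open>S\<close> itself for the vanishing order of
  \<open>gen_poly\<close>.\<close>

locale substitution =
  fixes h :: "'k::field_char_0 \<Rightarrow> 'a::comm_ring_1" and g :: "'n::finite \<Rightarrow> 'a"
  assumes h_zero [simp]: "h 0 = 0" and h_one [simp]: "h 1 = 1"
    and h_add: "h (a + b) = h a + h b" and h_mult: "h (a * b) = h a * h b"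
begin

definition mon_val :: "('n \<Rightarrow>\<^sub>0 nat) \<Rightarrow> 'a" where
  "mon_val m = (\<Prod>v\<in>UNIV. g v ^ Poly_Mapping.lookup m v)"

definition subst_hom :: "('n, 'k) mvpoly \<Rightarrow> 'a" where
  "subst_hom p = (\<Sum>m\<in>Poly_Mapping.keys p. h (Poly_Mapping.lookup p m) * mon_val m)"

lemma mon_val_add: "mon_val (a + b) = mon_val a * mon_val b"
  by (simp add: mon_val_def lookup_add power_add prod.distrib)

lemma mon_val_single: "mon_val (Poly_Mapping.single v 1) = g v"
  using prod.remove[of UNIV v "\<lambda>x. g x ^ (1 when v = x)"]
  by (simp add: mon_val_def lookup_single)

lemma subst_hom_superset:
  assumes "finite A" "Poly_Mapping.keys p \<subseteq> A"
  shows "subst_hom p = (\<Sum>m\<in>A. h (Poly_Mapping.lookup p m) * mon_val m)"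
  unfolding subst_hom_def using assms by (intro sum.mono_neutral_left) (auto simp: in_keys_iff)

lemma subst_hom_zero [simp]: "subst_hom 0 = 0"
  by (simp add: subst_hom_def)

lemma subst_hom_single: "subst_hom (Poly_Mapping.single m c) = h c * mon_val m"
  by (simp add: subst_hom_def)

lemma subst_hom_one [simp]: "subst_hom 1 = 1"
  by (simp add: subst_hom_def mon_val_def)

lemma subst_hom_add: "subst_hom (p + q) = subst_hom p + subst_hom q"
  using keys_add[of p q]
  by (simp add: subst_hom_superset[of "Poly_Mapping.keys p \<union> Poly_Mapping.keys q"] lookup_add h_add
      distrib_right sum.distrib)

lemma subst_hom_mult: "subst_hom (p * q) = subst_hom p * subst_hom q"
proof (induction p rule: mvpoly_induct)
  case (single m c)
  show ?case
    by (induction q rule: mvpoly_induct)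
       (simp_all add: mult_single subst_hom_single subst_hom_add mon_val_add h_mult algebra_simps)
qed (simp_all add: subst_hom_add distrib_right)

lemma subst_hom_power: "subst_hom (p ^ k) = subst_hom p ^ k"
  by (induction k) (simp_all add: subst_hom_mult)

lemma subst_hom_sum: "subst_hom (sum f A) = (\<Sum>x\<in>A. subst_hom (f x))"
  by (induction A rule: infinite_finite_induct) (simp_all add: subst_hom_add)

lemma subst_hom_ell: "subst_hom ell = (\<Sum>v\<in>UNIV. g v)"
  by (simp add: ell_def var_def monomial_def subst_hom_sum subst_hom_single mon_val_single del: One_nat_def)

end

definition weight :: "('n::finite \<Rightarrow> nat) \<Rightarrow> ('n \<Rightarrow>\<^sub>0 nat) \<Rightarrow> nat" where
  "weight w m = (\<Sum>v\<in>UNIV. w v * Poly_Mapping.lookup m v)"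

text \<open>The weights are \<open>b\<^sup>k\<close> with \<open>k\<close> an index of the variable; two exponent vectors collide only when
  \<open>b\<close> is a root of the nonzero polynomial whose coefficients are the differences of the exponents.\<close>

lemma ex_separating_weight:
  fixes E :: "('n::finite \<Rightarrow>\<^sub>0 nat) set"
  assumes "finite E"
  obtains w where "inj_on (weight w) E"
proof -
  obtain idx :: "'n \<Rightarrow> nat" where idx: "inj idx"
    using finite_imp_inj_to_nat_seg[of "UNIV :: 'n set"] by auto
  define D where "D m m' = (\<Sum>v\<in>UNIV.
    monom (int (Poly_Mapping.lookup m v) - int (Poly_Mapping.lookup m' v)) (idx v))"
    for m m' :: "'n \<Rightarrow>\<^sub>0 nat"
  have D0: "D m m' \<noteq> 0" if ne: "m \<noteq> m'" for m m'
  proof -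
    obtain u where u: "Poly_Mapping.lookup m u \<noteq> Poly_Mapping.lookup m' u"
      using ne poly_mapping_eqI[of m m'] by auto
    have "coeff (D m m') (idx u) = (\<Sum>v\<in>UNIV. if v = u
        then int (Poly_Mapping.lookup m v) - int (Poly_Mapping.lookup m' v) else 0)"
      unfolding D_def coeff_sum by (rule sum.cong) (use idx in \<open>auto simp: inj_eq\<close>)
    with u have "coeff (D m m') (idx u) \<noteq> 0" by simp
    then show ?thesis by auto
  qed
  have "finite (\<Union>m\<in>E. \<Union>m'\<in>E - {m}. {x. poly (D m m') x = 0})"
    using assms D0 by (intro finite_UN_I poly_roots_finite) auto
  then have "finite (int -` (\<Union>m\<in>E. \<Union>m'\<in>E - {m}. {x. poly (D m m') x = 0}))"
    by (rule finite_vimageI) simp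
  then obtain b where b: "b \<notin> int -` (\<Union>m\<in>E. \<Union>m'\<in>E - {m}. {x. poly (D m m') x = 0})"
    using ex_new_if_finite[OF infinite_UNIV_nat] by blast
  have D: "poly (D m m') (int b) =
    int (weight (\<lambda>v. b ^ idx v) m) - int (weight (\<lambda>v. b ^ idx v) m')" for m m'
    unfolding D_def poly_sum poly_monom weight_def left_diff_distrib sum_subtractf
    by (simp add: mult.commute)
  have "inj_on (weight (\<lambda>v. b ^ idx v)) E"
  proof (rule inj_onI, rule ccontr)
    fix m m' assume "m \<in> E" "m' \<in> E" "weight (\<lambda>v. b ^ idx v) m = weight (\<lambda>v. b ^ idx v) m'" "m \<noteq> m'"
    then show False using b D[of m m'] by auto
  qed
  then show ?thesis by (rule that)
qed

lemma prod_monom: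
  "finite A \<Longrightarrow> (\<Prod>v\<in>A. monom (a v) (e v)) = monom (\<Prod>v\<in>A. a v) (\<Sum>v\<in>A. e v)"
  by (induction A rule: finite_induct) (auto simp: mult_monom one_pCons monom_0)

lemma prod_var_power:
  "(\<Prod>v\<in>UNIV. var v ^ Poly_Mapping.lookup m v) = (monomial m :: ('a::finite, 'b::field_char_0) mvpoly)"
proof -
  have pow: "(var v :: ('a, 'b) mvpoly) ^ k = Poly_Mapping.single (Poly_Mapping.single v k) 1" for v :: 'a and k
    by (induction k) (simp_all add: var_def monomial_def mult_single flip: single_add)
  have "(\<Prod>v\<in>A. Poly_Mapping.single (f v) (1 :: 'b)) = Poly_Mapping.single (\<Sum>v\<in>A. f v) 1"
    for f :: "'a \<Rightarrow> 'a \<Rightarrow>\<^sub>0 nat" and A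
    by (induction A rule: infinite_finite_induct) (simp_all add: mult_single)
  moreover have "(\<Sum>v\<in>UNIV. Poly_Mapping.single v (Poly_Mapping.lookup m v)) = m"
    by (rule poly_mapping_eqI) (simp add: lookup_sum lookup_single when_def)
  ultimately show ?thesis by (simp add: pow monomial_def)
qed

text \<open>For separating weights the substitution of \<open>T^(w v)\<close> for the variable
  \<open>v\<close> sends distinct monomials of \<open>p\<close>, and likewise of \<open>q\<close>,
  to distinct powers of \<open>T\<close>. Both images are therefore nonzero, and univariate
  polynomials over a field form a domain.\<close>

lemma mvpoly_no_zero_divisors:
  fixes p q :: "('n::finite, 'k::field_char_0) mvpoly"
  assumes "p \<noteq> 0" "q \<noteq> 0"
  shows "p * q \<noteq> 0"
proof -
  obtain w where w: "inj_on (weight w) (Poly_Mapping.keys p \<union> Poly_Mapping.keys q)"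
    by (rule ex_separating_weight[of "Poly_Mapping.keys p \<union> Poly_Mapping.keys q"]) auto
  interpret substitution "\<lambda>c::'k. [:c:]" "\<lambda>v::'n. monom 1 (w v)"
    by unfold_locales auto
  have val: "mon_val m = monom 1 (weight w m)" for m
    by (simp add: mon_val_def weight_def monom_power prod_monom mult.commute)
  have nz: "subst_hom r \<noteq> 0" if "r \<noteq> 0" "inj_on (weight w) (Poly_Mapping.keys r)" for r
  proof -
    from that(1) obtain m where m: "m \<in> Poly_Mapping.keys r"
      by (metis all_not_in_conv keys_eq_empty)
    have "coeff (subst_hom r) (weight w m) = (\<Sum>m'\<in>Poly_Mapping.keys r.
        if m' = m then Poly_Mapping.lookup r m' else 0)"
      unfolding subst_hom_def val coeff_sum
      by (rule sum.cong) (use m that(2) in \<open>auto dest: inj_onD\<close>)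
    with m have "coeff (subst_hom r) (weight w m) \<noteq> 0" by (simp add: in_keys_iff)
    then show ?thesis by auto
  qed
  have "subst_hom (p * q) \<noteq> 0"
    unfolding subst_hom_mult
    using nz[OF assms(1)] nz[OF assms(2)] w by (simp add: inj_on_Un)
  then show ?thesis by auto
qed

lemma mvpoly_power_nonzero: "l \<noteq> 0 \<Longrightarrow> l ^ i \<noteq> (0 :: ('n::finite, 'k::field_char_0) mvpoly)"
  by (induction i) (auto dest: mvpoly_no_zero_divisors)

section \<open>Orders of vanishing in a space of univariate polynomials\<close>

lemma pderiv_sum: "pderiv (sum f A) = (\<Sum>x\<in>A. pderiv (f x))"
  by (induction A rule: infinite_finite_induct) (simp_all add: pderiv_add)

text \<open>No nonzero element of the span of the first \<open>n\<close> polynomials vanishes to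
  order \<open>n\<close> at \<open>t\<close>. The conclusion is that the combination is zero, not
  its coefficients, so the family may be linearly dependent.\<close>

definition vanishing_bound :: "'k::field_char_0 \<Rightarrow> nat \<Rightarrow> (nat \<Rightarrow> 'k poly) \<Rightarrow> bool" where
  "vanishing_bound t n F \<longleftrightarrow> (\<forall>c. [:- t, 1:] ^ n dvd (\<Sum>i<n. smult (c i) (F i)) \<longrightarrow>
     (\<Sum>i<n. smult (c i) (F i)) = 0)"

lemma vanishing_bound_0: "vanishing_bound t 0 F"
  by (simp add: vanishing_bound_def)

lemma vanishing_bound_Suc_zero:
  assumes "vanishing_bound t n F" "F n = 0"
  shows "vanishing_bound t (Suc n) F"
  unfolding vanishing_bound_def
proof (intro allI impI)
  fix c assume "[:- t, 1:] ^ Suc n dvd (\<Sum>i<Suc n. smult (c i) (F i))"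
  then have "[:- t, 1:] ^ n dvd (\<Sum>i<n. smult (c i) (F i))"
    using assms(2) dvd_mult_right[of "[:- t, 1:]" "[:- t, 1:] ^ n"] by (simp del: mult_pCons_left)
  with assms show "(\<Sum>i<Suc n. smult (c i) (F i)) = 0"
    by (auto simp: vanishing_bound_def)
qed

text \<open>The Wronskian-type operator \<open>g \<mapsto> h' g - h g'\<close> with \<open>h = F n\<close> kills \<open>h\<close> and lowers orders of
  vanishing by one only, so it reduces the number of generators.\<close>

lemma vanishing_bound_Suc:
  fixes F :: "nat \<Rightarrow> 'k::field_char_0 poly"
  assumes IH: "vanishing_bound t n (\<lambda>i. pderiv (F n) * F i - F n * pderiv (F i))"
    and ht: "poly (F n) t \<noteq> 0"
  shows "vanishing_bound t (Suc n) F"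
  unfolding vanishing_bound_def
proof (intro allI impI)
  fix c
  define g where "g = (\<Sum>i<Suc n. smult (c i) (F i))"
  define h where "h = F n"
  assume "[:- t, 1:] ^ Suc n dvd (\<Sum>i<Suc n. smult (c i) (F i))"
  then obtain k where k: "g = [:- t, 1:] ^ Suc n * k" unfolding g_def by (auto simp: dvd_def)
  have "pderiv ([:- t, 1:] ^ Suc n) = smult (of_nat (Suc n)) ([:- t, 1:] ^ n)"
    by (simp add: pderiv_power_Suc pderiv_pCons del: of_nat_Suc power_Suc)
  then have "pderiv g = [:- t, 1:] ^ n * (smult (of_nat (Suc n)) k + [:- t, 1:] * pderiv k)"
    unfolding k pderiv_mult by (simp add: algebra_simps)
  moreover have "g = [:- t, 1:] ^ n * ([:- t, 1:] * k)"
    unfolding k by (simp add: algebra_simps)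
  ultimately have "[:- t, 1:] ^ n dvd pderiv h * g - h * pderiv g"
    by (metis dvd_diff dvd_mult dvd_triv_left)
  moreover have D: "pderiv h * g - h * pderiv g =
    (\<Sum>i<n. smult (c i) (pderiv (F n) * F i - F n * pderiv (F i)))"
    by (simp add: g_def h_def pderiv_sum pderiv_smult sum_distrib_left sum_subtractf algebra_simps
        smult_diff_right pderiv_add del: of_nat_Suc)
  ultimately have eq: "pderiv h * g = h * pderiv g"
    using IH by (auto simp: vanishing_bound_def)
  show "g = 0"
  proof (rule ccontr)
    assume "g \<noteq> 0"
    have "poly g t = 0" unfolding k by simp
    have "Polynomial.degree g \<noteq> 0"
    proof
      assume "Polynomial.degree g = 0"
      then obtain a where "g = [:a:]" by (rule degree_eq_zeroE)
      with \<open>poly g t = 0\<close> \<open>g \<noteq> 0\<close> show False by simp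
    qed
    then have g': "pderiv g \<noteq> 0" by (simp add: pderiv_eq_0_iff)
    \<comment> \<open>In characteristic zero differentiation lowers the order at a root by exactly
      one. As \<open>h\<close> does not vanish at \<open>t\<close>, the right side of
      \<open>pderiv h * g = h * pderiv g\<close> has order one less than \<open>g\<close>, whereas
      the left side has at least the order of \<open>g\<close>.\<close>
    have ord: "order t g = Suc (order t (pderiv g))"
      by (rule order_pderiv[OF \<open>g \<noteq> 0\<close> \<open>poly g t = 0\<close>])
    have h0: "h \<noteq> 0" "order t h = 0" using ht by (auto simp: h_def order_root)
    then have "order t (h * pderiv g) = order t (pderiv g)"
      using g' by (simp add: order_mult)
    moreover have "pderiv h * g \<noteq> 0" using eq h0 g' by simp
    then have "order t (pderiv h * g) \<ge> order t g" by (simp add: order_mult)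
    ultimately show False using eq ord by simp
  qed
qed

text \<open>Each step of the induction adds at most the finitely many roots of \<open>F n\<close> to
  the exceptional points; a zero \<open>F n\<close> adds none.\<close>

lemma finite_not_vanishing_bound:
  fixes F :: "nat \<Rightarrow> 'k::field_char_0 poly"
  shows "finite {t. \<not> vanishing_bound t n F}"
proof (induction n arbitrary: F)
  case (Suc n)
  show ?case
  proof (cases "F n = 0")
    case True
    then have "{t. \<not> vanishing_bound t (Suc n) F} \<subseteq> {t. \<not> vanishing_bound t n F}"
      using vanishing_bound_Suc_zero by blast
    then show ?thesis using Suc finite_subset by blast
  next
    case False
    have "{t. \<not> vanishing_bound t (Suc n) F} \<subseteq>
      {t. \<not> vanishing_bound t n (\<lambda>i. pderiv (F n) * F i - F n * pderiv (F i))} \<union> {t. poly (F n) t = 0}"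
      using vanishing_bound_Suc by blast
    then show ?thesis using Suc poly_roots_finite[OF False] finite_subset by blast
  qed
qed (simp add: vanishing_bound_0)

text \<open>The Wronskian-type operator turns two monomials into a monomial again, so the induction
  stays among monomials, and a nonzero monomial never vanishes at 1.\<close>

lemma vanishing_bound_monom:
  fixes a :: "nat \<Rightarrow> 'k::field_char_0"
  shows "vanishing_bound 1 n (\<lambda>i. monom (a i) (e i))"
proof (induction n arbitrary: a e)
  case (Suc n)
  show ?case
  proof (cases "a n = 0")
    case True
    then show ?thesis using Suc by (intro vanishing_bound_Suc_zero) auto
  next
    case False
    \<comment> \<open>If both exponents are 0, the exponent on the right is truncated, but its
      coefficient is 0.\<close>
    have "pderiv (monom (a n) (e n)) * monom (a i) (e i) - monom (a n) (e n) * pderiv (monom (a i) (e i)) =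
      monom (a n * a i * (of_nat (e n) - of_nat (e i))) (e n + e i - 1)" for i
      by (cases "e n"; cases "e i")
         (simp_all add: pderiv_monom mult_monom algebra_simps diff_monom minus_monom del: of_nat_Suc)
    then show ?thesis
      using Suc[of "\<lambda>i. a n * a i * (of_nat (e n) - of_nat (e i))" "\<lambda>i. e n + e i - 1"] False
      by (intro vanishing_bound_Suc) (simp_all add: poly_monom)
  qed
qed (simp add: vanishing_bound_0)

section \<open>Powers of linear forms on a curve\<close>

lemma lookup_var_mult:
  "Poly_Mapping.lookup (var v * p) m = (if Poly_Mapping.lookup m v = 0 then 0
     else Poly_Mapping.lookup p (m - Poly_Mapping.single v 1))"
proof (induction p rule: mvpoly_induct)
  case (single k c)
  have "Poly_Mapping.single v 1 + k = m \<longleftrightarrow>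
      Poly_Mapping.lookup m v \<noteq> 0 \<and> k = m - Poly_Mapping.single v 1"
  proof
    assume "Poly_Mapping.lookup m v \<noteq> 0 \<and> k = m - Poly_Mapping.single v 1"
    then show "Poly_Mapping.single v 1 + k = m"
      by (auto intro!: poly_mapping_eqI simp: lookup_add lookup_minus lookup_single when_def)
  qed (auto simp: lookup_add)
  then show ?case
    by (auto simp: var_def monomial_def mult_single lookup_single when_def)
qed (auto simp: algebra_simps lookup_add)

text \<open>These are multinomial coefficients: positive natural numbers, which stay nonzero in
  characteristic zero. Positivity follows by induction on \<open>d\<close>, since multiplication by
  \<open>ell\<close> sums over the variables that can be removed from \<open>m\<close>.\<close>

lemma lookup_ell_power_nonzero:
  assumes "mon_deg m = d"
  shows "Poly_Mapping.lookup (ell ^ d :: ('n::finite, 'k::field_char_0) mvpoly) m \<noteq> 0"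
proof -
  have "\<exists>N. Poly_Mapping.lookup (ell ^ d :: ('n, 'k) mvpoly) m = of_nat N \<and> (mon_deg m = d \<longrightarrow> N > 0)" for m
  proof (induction d arbitrary: m)
    case 0
    then show ?case
      by (cases "m = 0") (auto intro: exI[of _ 1] exI[of _ 0] simp: lookup_one)
  next
    case (Suc d)
    then obtain N where N: "\<And>m. Poly_Mapping.lookup (ell ^ d :: ('n, 'k) mvpoly) m = of_nat (N m)"
      "\<And>m. mon_deg m = d \<Longrightarrow> N m > 0" by metis
    let ?N = "\<lambda>v. if Poly_Mapping.lookup m v = 0 then 0 else N (m - Poly_Mapping.single v 1)"
    have "Poly_Mapping.lookup (ell ^ Suc d :: ('n, 'k) mvpoly) m = of_nat (\<Sum>v\<in>UNIV. ?N v)"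
      unfolding power_Suc ell_def[of] sum_distrib_right lookup_sum lookup_var_mult of_nat_sum
      by (rule sum.cong) (auto simp: N(1) simp flip: ell_def)
    moreover have "(\<Sum>v\<in>UNIV. ?N v) > 0" if deg: "mon_deg m = Suc d"
    proof -
      obtain v m' where m: "m = Poly_Mapping.single v 1 + m'" "mon_deg m' = d"
        using mon_deg_Suc_decomp[OF deg] by blast
      then have "?N v > 0" using N(2)[of m'] by (simp add: lookup_add)
      then show ?thesis by (intro sum_pos2[of _ v]) auto
    qed
    ultimately show ?case by blast
  qed
  with assms show ?thesis by (metis of_nat_eq_0_iff less_numeral_extra(3))
qed

lemma keys_ell_power: "Poly_Mapping.keys (ell ^ d :: ('n::finite, 'k::field_char_0) mvpoly) = {m. mon_deg m = d}"
proof
  show "Poly_Mapping.keys (ell ^ d :: ('n, 'k) mvpoly) \<subseteq> {m. mon_deg m = d}"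
    using S_piece_power[OF ell_in_S_piece, of d] unfolding S_piece_def by blast
  show "{m. mon_deg m = d} \<subseteq> Poly_Mapping.keys (ell ^ d :: ('n, 'k) mvpoly)"
    by (rule subsetI, simp only: mem_Collect_eq in_keys_iff) (rule lookup_ell_power_nonzero)
qed

section \<open>Linear functionals and the polynomials they induce along the curve\<close>

definition linear_functional :: "(('n::finite, 'k::field_char_0) mvpoly \<Rightarrow> 'k) \<Rightarrow> bool" where
  "linear_functional \<phi> \<longleftrightarrow> (\<forall>p q. \<phi> (p + q) = \<phi> p + \<phi> q) \<and> (\<forall>c p. \<phi> (const c * p) = c * \<phi> p)"

lemma linear_functional_0: "linear_functional \<phi> \<Longrightarrow> \<phi> 0 = 0"
  unfolding linear_functional_def by (metis mult_zero_left single_zero)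

lemma linear_functional_sum: "linear_functional \<phi> \<Longrightarrow> \<phi> (sum f A) = (\<Sum>x\<in>A. \<phi> (f x))"
  by (induction A rule: infinite_finite_induct)
     (simp_all add: linear_functional_0, simp add: linear_functional_def)

lemma linear_functional_diff: "linear_functional \<phi> \<Longrightarrow> \<phi> (p - q) = \<phi> p - \<phi> q"
  unfolding linear_functional_def by (metis add_diff_cancel_right' diff_add_cancel)

text \<open>A basis \<open>B\<close> of the subspace \<open>W\<close> stays independent after
  inserting \<open>x\<close>, so prescribing 1 on \<open>x\<close> and 0 on \<open>B\<close> extends
  to a functional. It serves to prove membership in an ideal by contradiction.\<close>

lemma ex_linear_functional:
  fixes W :: "('n::finite, 'k::field_char_0) mvpoly set"
  assumes "0 \<in> W" "\<And>p q. p \<in> W \<Longrightarrow> q \<in> W \<Longrightarrow> p + q \<in> W" "\<And>c p. p \<in> W \<Longrightarrow> const c * p \<in> W"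
    and "x \<notin> W"
  obtains \<phi> where "linear_functional \<phi>" "\<And>p. p \<in> W \<Longrightarrow> \<phi> p = 0" "\<phi> x = 1"
proof -
  interpret VP: vector_space_pair "\<lambda>c (p :: ('n, 'k) mvpoly). const c * p" "(*) :: 'k \<Rightarrow> 'k \<Rightarrow> 'k"
    by unfold_locales
       (simp_all add: distrib_left distrib_right single_add mult_single mult.assoc[symmetric])
  obtain B where B: "B \<subseteq> W" "VP.vs1.independent B" "W \<subseteq> VP.vs1.span B"
    by (rule VP.vs1.maximal_independent_subset)
  have "VP.vs1.span B \<subseteq> W"
    by (rule VP.vs1.span_minimal[OF B(1)]) (use assms in \<open>auto simp: VP.vs1.subspace_def\<close>)
  then have "x \<notin> VP.vs1.span B" using assms(4) by blast
  then have "VP.vs1.independent (insert x B)" and "x \<notin> B"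
    using B(2) VP.vs1.span_base by (auto simp: VP.vs1.independent_insert)
  then obtain \<phi> where \<phi>: "Vector_Spaces.linear (\<lambda>c (p :: ('n, 'k) mvpoly). const c * p) (*) \<phi>"
    "\<forall>y\<in>insert x B. \<phi> y = (if y = x then 1 else 0)"
    using VP.linear_independent_extend[of "insert x B" "\<lambda>y. if y = x then 1 else 0"] by blast
  then interpret L: Vector_Spaces.linear "\<lambda>c (p :: ('n, 'k) mvpoly). const c * p" "(*)" \<phi> by simp
  show ?thesis
  proof (rule that[of \<phi>])
    show "linear_functional \<phi>" by (simp add: linear_functional_def L.add L.scale)
    show "\<phi> x = 1" using \<phi> by simp
    fix p assume "p \<in> W"
    then have "p \<in> VP.vs1.span B" using B(3) by blast
    moreover have "\<phi> b = 0" if "b \<in> B" for b using \<phi>(2) \<open>x \<notin> B\<close> that by auto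
    ultimately show "\<phi> p = 0" by (rule L.eq_0_on_span[rotated])
  qed
qed

lemma smult_sum_right: "smult c (sum f A) = (\<Sum>x\<in>A. smult c (f x))"
  by (induction A rule: infinite_finite_induct) (simp_all add: smult_add_right)

definition curve :: "('n::finite \<Rightarrow> nat) \<Rightarrow> 'k::field_char_0 \<Rightarrow> ('n, 'k) mvpoly" where
  "curve w t = (\<Sum>v\<in>UNIV. const (t ^ w v) * var v)"

lemma curve_1: "curve w 1 = ell"
  by (simp add: curve_def ell_def)

lemma curve_in_S_piece: "curve w t \<in> S_piece 1"
  unfolding curve_def
  by (intro S_piece_sum S_piece_const_mult) (simp add: var_def monomial_in_S_piece)

lemma curve_nonzero:
  fixes w :: "'n::finite \<Rightarrow> nat" and t :: "'k::field_char_0"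
  assumes "t \<noteq> 0"
  shows "curve w t \<noteq> 0"
proof
  fix v :: 'n
  assume "curve w t = 0"
  then have "Poly_Mapping.lookup (curve w t) (Poly_Mapping.single v 1) = 0" by simp
  moreover have "Poly_Mapping.lookup (curve w t) (Poly_Mapping.single v 1) =
      (\<Sum>u\<in>UNIV. if u = v then t ^ w u else 0)"
    unfolding curve_def lookup_sum lookup_const_mult
    by (rule sum.cong) (auto simp: var_def monomial_def lookup_single when_def dest!: arg_cong[of _ _ Poly_Mapping.keys])
  ultimately show False using assms by simp
qed

definition gen_poly :: "nat \<Rightarrow> ('n::finite \<Rightarrow> nat) \<Rightarrow> (('n, 'k::field_char_0) mvpoly \<Rightarrow> 'k) \<Rightarrow> 'k poly" where
  "gen_poly d w \<phi> = (\<Sum>m\<in>{m. mon_deg m = d}.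
     monom (Poly_Mapping.lookup (ell ^ d :: ('n, 'k) mvpoly) m * \<phi> (monomial m)) (weight w m))"

text \<open>Separating weights keep the monomials of degree \<open>d\<close> on different powers of
  \<open>T\<close>, so each value of \<open>\<phi>\<close> can be read off from a single
  coefficient.\<close>

lemma coeff_gen_poly:
  fixes \<phi> :: "('n::finite, 'k::field_char_0) mvpoly \<Rightarrow> 'k"
  assumes "inj_on (weight w) {m. mon_deg m = d}" "mon_deg m = d"
  shows "coeff (gen_poly d w \<phi>) (weight w m) = Poly_Mapping.lookup (ell ^ d :: ('n, 'k) mvpoly) m * \<phi> (monomial m)"
proof -
  have "coeff (gen_poly d w \<phi>) (weight w m) = (\<Sum>m'\<in>{m. mon_deg m = d}.
      if m' = m then Poly_Mapping.lookup (ell ^ d :: ('n, 'k) mvpoly) m' * \<phi> (monomial m') else 0)"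
    unfolding gen_poly_def coeff_sum
    by (rule sum.cong) (use assms in \<open>auto dest: inj_onD\<close>)
  then show ?thesis using assms(2) by (simp add: finite_mon_deg)
qed

lemma map_poly_linear_functional_sum:
  "linear_functional \<phi> \<Longrightarrow> map_poly \<phi> (sum f A) = (\<Sum>x\<in>A. map_poly \<phi> (f x))"
  by (rule poly_eqI) (simp add: coeff_map_poly linear_functional_0 coeff_sum linear_functional_sum)

text \<open>\<open>gen_poly d w \<phi>\<close> is \<open>\<phi>\<close> applied coefficientwise to the \<open>d\<close>-th power of \<open>P = \<Sum>\<^sub>v x\<^sub>v T\<^bsup>w v\<^esup>\<close>, and
  \<open>P\<close> is congruent to \<open>curve w t\<close> modulo \<open>T - t\<close>. In the binomial expansion of \<open>P\<^sup>d\<close> around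
  \<open>curve w t\<close>, the functional \<open>\<phi>\<close> kills the terms containing \<open>(curve w t)\<^sup>i\<close>.\<close>

lemma gen_poly_dvd:
  fixes \<phi> :: "('n::finite, 'k::field_char_0) mvpoly \<Rightarrow> 'k"
  assumes \<phi>: "linear_functional \<phi>" and i: "i \<le> d"
    and kill: "\<And>q. \<phi> (curve w t ^ i * q) = 0"
  shows "[:- t, 1:] ^ (d - i + 1) dvd gen_poly d w \<phi>"
proof -
  note \<phi>0 = linear_functional_0[OF \<phi>]
  interpret substitution "\<lambda>c::'k. [:const c :: ('n, 'k) mvpoly:]" "\<lambda>v::'n. monom (var v) (w v)"
    by unfold_locales (auto simp: single_add mult_single one_pCons mult.commute)
  define P where "P = subst_hom ell"
  define \<Phi> where "\<Phi> = map_poly \<phi>"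
  note \<Phi>_sum = map_poly_linear_functional_sum[OF \<phi>, folded \<Phi>_def]
  \<comment> \<open>Applying \<open>\<phi>\<close> coefficientwise is linear only over
    \<open>'k\<close>, which suffices because the factor \<open>T - t\<close> has its coefficients
    in \<open>'k\<close>.\<close>
  have \<Phi>_step: "\<Phi> ([:- const t, 1:] * F) = [:- t, 1:] * \<Phi> F" for F
  proof (rule poly_eqI)
    fix k
    have "const (- t) * p = - (const t * p)" for p :: "('n, 'k) mvpoly"
      by (simp add: single_uminus)
    then have "\<phi> (p - const t * q) = \<phi> p - t * \<phi> q" for p q
      using \<phi> by (simp add: linear_functional_diff linear_functional_def)
    from this[of 0] this show "coeff (\<Phi> ([:- const t, 1:] * F)) k = coeff ([:- t, 1:] * \<Phi> F) k"
      by (simp add: \<Phi>_def coeff_map_poly \<phi>0 coeff_pCons split: nat.splits)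
  qed
  have \<Phi>_pow: "\<Phi> ([:- const t, 1:] ^ k * F) = [:- t, 1:] ^ k * \<Phi> F" for k F
    by (induction k) (simp_all add: \<Phi>_step mult.assoc del: mult_pCons_left)
  have val: "mon_val m = monom (monomial m) (weight w m)" for m
    by (simp add: mon_val_def weight_def monom_power prod_monom prod_var_power mult.commute)
  have Pd: "P ^ d = (\<Sum>m\<in>{m. mon_deg m = d}.
      monom (const (Poly_Mapping.lookup (ell ^ d :: ('n, 'k) mvpoly) m) * monomial m) (weight w m))"
    unfolding P_def subst_hom_power[symmetric]
    by (simp add: subst_hom_def keys_ell_power val smult_monom)
  have gen: "\<Phi> (P ^ d) = gen_poly d w \<phi>"
    unfolding gen_poly_def Pd \<Phi>_sum
    using \<phi> by (simp add: \<Phi>_def map_poly_monom \<phi>0 linear_functional_def)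
  have "poly P (const t) = curve w t"
  proof -
    have "const t ^ k = (const (t ^ k) :: ('n, 'k) mvpoly)" for k
      by (induction k) (simp_all add: mult_single)
    then show ?thesis
      by (simp add: P_def subst_hom_ell curve_def poly_sum poly_monom mult.commute)
  qed
  then have "poly (P - [:curve w t:]) (const t) = 0" by simp
  then obtain Q where Q: "P - [:curve w t:] = [:- const t, 1:] * Q"
    unfolding poly_eq_0_iff_dvd by (auto simp: dvd_def)
  then have "P = [:curve w t:] + [:- const t, 1:] * Q" by (simp add: algebra_simps)
  then have "P ^ d = (\<Sum>k\<le>d. of_nat (d choose k) * [:curve w t:] ^ k * ([:- const t, 1:] * Q) ^ (d - k))"
    by (simp only: binomial_ring)
  then have "gen_poly d w \<phi> =
      (\<Sum>k\<le>d. \<Phi> (of_nat (d choose k) * [:curve w t:] ^ k * ([:- const t, 1:] * Q) ^ (d - k)))"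
    by (simp add: \<Phi>_sum flip: gen)
  also have "[:- t, 1:] ^ (d - i + 1) dvd \<dots>"
  proof (rule dvd_sum)
    fix k assume "k \<in> {..d}"
    let ?X = "of_nat (d choose k) * [:curve w t:] ^ k * ([:- const t, 1:] * Q) ^ (d - k)"
    show "[:- t, 1:] ^ (d - i + 1) dvd \<Phi> ?X"
    proof (cases "i \<le> k")
      case True
      then have "[:curve w t:] ^ k = [:curve w t ^ i:] * [:curve w t:] ^ (k - i)"
        by (simp add: poly_const_pow flip: power_add)
      then have "?X = smult (curve w t ^ i) (of_nat (d choose k) * [:curve w t:] ^ (k - i) * ([:- const t, 1:] * Q) ^ (d - k))"
        by (simp only: mult.assoc mult.left_commute) simp
      moreover have "\<Phi> (smult (curve w t ^ i) F) = 0" for F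
        by (rule poly_eqI) (simp add: \<Phi>_def coeff_map_poly \<phi>0 kill)
      ultimately show ?thesis by simp
    next
      case False
      \<comment> \<open>Here \<open>k < i\<close>, so the power of \<open>T - t\<close> reaches the
        required exponent, with \<open>i - k - 1\<close> factors to spare.\<close>
      then have "d - k = (d - i + 1) + (i - k - 1)" using i by simp
      then have "?X = [:- const t, 1:] ^ (d - i + 1) *
          (of_nat (d choose k) * [:curve w t:] ^ k * [:- const t, 1:] ^ (i - k - 1) * Q ^ (d - k))"
        by (simp only: power_mult_distrib power_add mult_ac)
      then show ?thesis by (simp only: \<Phi>_pow dvd_triv_left)
    qed
  qed
  finally show ?thesis .
qed

text \<open>For an ideal \<open>I\<close> this is \<open>I + (f)\<close>. It stands for surjectivity
  without degrees: the forms of degree \<open>k\<close> in it are those hit by \<open>f\<close>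
  modulo \<open>I\<close>.\<close>

definition adjoin ::
  "('n::finite, 'k::field_char_0) mvpoly set \<Rightarrow> ('n, 'k) mvpoly \<Rightarrow> ('n, 'k) mvpoly set" where
  "adjoin I f = {x + f * r |x r. x \<in> I}"

lemma adjoin_incl: "I \<subseteq> adjoin I f"
proof
  fix x assume "x \<in> I"
  moreover have "x = x + f * 0" by simp
  ultimately show "x \<in> adjoin I f" unfolding adjoin_def by blast
qed

lemma mult_in_adjoin: "ideal I S_ring \<Longrightarrow> f * r \<in> adjoin I f"
  using ideal_0[of I] unfolding adjoin_def by (metis (mono_tags, lifting) add_0 mem_Collect_eq)

lemma mem_adjoin_iff: "p \<in> adjoin I f \<longleftrightarrow> (\<exists>r. p - f * r \<in> I)"
proof
  assume "\<exists>r. p - f * r \<in> I"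
  then obtain r where "p - f * r \<in> I" by blast
  moreover have "p = (p - f * r) + f * r" by simp
  ultimately show "p \<in> adjoin I f" unfolding adjoin_def by blast
next
  assume "p \<in> adjoin I f"
  then obtain x r where "x \<in> I" "p - f * r = x" unfolding adjoin_def by fastforce
  then show "\<exists>r. p - f * r \<in> I" by metis
qed

lemma adjoin_mult_subset: "adjoin I (f * g) \<subseteq> adjoin I f"
proof
  fix p assume "p \<in> adjoin I (f * g)"
  then obtain r where "p - f * (g * r) \<in> I" by (auto simp: mem_adjoin_iff mult.assoc)
  then show "p \<in> adjoin I f" unfolding mem_adjoin_iff by blast
qed

lemma ideal_adjoin:
  fixes I :: "('n::finite, 'k::field_char_0) mvpoly set"
  assumes I: "ideal I S_ring"
  shows "ideal (adjoin I f) S_ring"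
  unfolding ideal_S_iff
proof (intro conjI ballI allI)
  show "0 \<in> adjoin I f" using adjoin_incl ideal_0[OF I] by blast
  fix x y r assume "x \<in> adjoin I f"
  then obtain x1 r1 where x: "x = x1 + f * r1" "x1 \<in> I" unfolding adjoin_def by auto
  have "r * x = r * x1 + f * (r * r1)" unfolding x by (simp add: algebra_simps)
  with ideal_mult[OF I x(2)] show "r * x \<in> adjoin I f" unfolding adjoin_def by blast
  assume "y \<in> adjoin I f"
  then obtain x2 r2 where y: "y = x2 + f * r2" "x2 \<in> I" unfolding adjoin_def by auto
  have "x + y = (x1 + x2) + f * (r1 + r2)" unfolding x y by (simp add: algebra_simps)
  with ideal_add[OF I x(2) y(2)] show "x + y \<in> adjoin I f" unfolding adjoin_def by blast
qed

text \<open>Taking components of degree \<open>k\<close> in \<open>p = x + f * r\<close> replaces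
  the arbitrary cofactor by a form of degree \<open>k - i\<close>; homogeneity keeps the component
  of \<open>x\<close> in \<open>I\<close>.\<close>

lemma adjoin_S_piece:
  fixes I :: "('n::finite, 'k::field_char_0) mvpoly set"
  assumes hom: "homogeneous_set I" and f: "f \<in> S_piece i" and i: "i \<le> k"
    and p: "p \<in> S_piece k" "p \<in> adjoin I f"
  shows "\<exists>r\<in>S_piece (k - i). p - f * r \<in> I"
proof -
  obtain x r where x: "p = x + f * r" "x \<in> I" using p(2) unfolding adjoin_def by auto
  have "p = hcomp k p" using p(1) by (simp add: hcomp_S_piece)
  also have "\<dots> = hcomp k x + f * hcomp (k - i) r"
    unfolding x(1) hcomp_add using i by (simp add: hcomp_mult[OF f])
  finally have "p - f * hcomp (k - i) r = hcomp k x" by simp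
  then show ?thesis using hom x(2) hcomp_in_S_piece by (metis homogeneous_set_def)
qed

text \<open>The scalars \<open>a m j\<close> are coordinates modulo \<open>I\<close> of the
  monomials of degree \<open>d\<close> with respect to \<open>q\<close>, and \<open>bound\<close>
  concerns the \<open>c\<close> coordinate polynomials, which involve neither a functional nor
  \<open>t\<close>. If some monomial stayed outside the enlarged ideal, a functional separating it
  would give a nonzero combination of these polynomials that vanishes to order
  \<open>d - i + 1\<close> at \<open>t\<close>, hence to order \<open>c\<close>.\<close>

lemma curve_power_surj:
  fixes I :: "('n::finite, 'k::field_char_0) mvpoly set"
  assumes I: "ideal I S_ring" and hom: "homogeneous_set I"
    and rep: "\<And>m. mon_deg m = d \<Longrightarrow> monomial m - (\<Sum>j<c. const (a m j) * q j) \<in> I"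
    and c: "c \<le> d - i + 1" and i: "i \<le> d"
    and w: "inj_on (weight w) {m. mon_deg m = d}"
    and bound: "vanishing_bound t c (\<lambda>j. \<Sum>m\<in>{m. mon_deg m = d}.
      monom (Poly_Mapping.lookup (ell ^ d :: ('n, 'k) mvpoly) m * a m j) (weight w m))"
    and p: "p \<in> S_piece d"
  shows "\<exists>r\<in>S_piece (d - i). p - curve w t ^ i * r \<in> I"
proof -
  define W where "W = adjoin I (curve w t ^ i)"
  have W: "ideal W S_ring" unfolding W_def by (rule ideal_adjoin[OF I])
  have "monomial m \<in> W" if m: "mon_deg m = d" for m
  proof (rule ccontr)
    assume "monomial m \<notin> W"
    then obtain \<phi> where \<phi>: "linear_functional \<phi>" "\<And>p. p \<in> W \<Longrightarrow> \<phi> p = 0" "\<phi> (monomial m) = 1"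
      using ex_linear_functional[of W "monomial m"] ideal_0[OF W] ideal_add[OF W] ideal_mult[OF W]
      by blast
    have IW: "x \<in> W" if "x \<in> I" for x
      using that adjoin_incl[of I] unfolding W_def by blast
    have "\<phi> (curve w t ^ i * r) = 0" for r
      using mult_in_adjoin[OF I] by (intro \<phi>(2)) (simp add: W_def)
    then have dvd: "[:- t, 1:] ^ (d - i + 1) dvd gen_poly d w \<phi>"
      by (intro gen_poly_dvd \<phi>(1) i)
    have \<phi>m: "\<phi> (monomial m) = (\<Sum>j<c. \<phi> (q j) * a m j)" if "mon_deg m = d" for m
    proof -
      have "\<phi> (monomial m - (\<Sum>j<c. const (a m j) * q j)) = 0"
        using rep[OF that] by (intro \<phi> IW)
      then show ?thesis
        using \<phi>(1) by (simp add: linear_functional_diff linear_functional_sum)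
          (simp add: linear_functional_def mult.commute)
    qed
    \<comment> \<open>Interchanging the sums exhibits the values \<open>\<phi> (q j)\<close> as the
      coefficients of the combination.\<close>
    have "gen_poly d w \<phi> = (\<Sum>j<c. smult (\<phi> (q j)) (\<Sum>m\<in>{m. mon_deg m = d}.
      monom (Poly_Mapping.lookup (ell ^ d :: ('n, 'k) mvpoly) m * a m j) (weight w m)))"
    proof -
      have "gen_poly d w \<phi> = (\<Sum>m\<in>{m. mon_deg m = d}. \<Sum>j<c. smult (\<phi> (q j))
        (monom (Poly_Mapping.lookup (ell ^ d :: ('n, 'k) mvpoly) m * a m j) (weight w m)))"
        unfolding gen_poly_def
        by (rule sum.cong)
           (auto simp: \<phi>m smult_monom sum_distrib_left mult_ac monom_sum)
      then show ?thesis by (subst (asm) sum.swap) (simp add: smult_sum_right)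
    qed
    moreover have "[:- t, 1:] ^ c dvd gen_poly d w \<phi>"
      using dvd le_imp_power_dvd[OF c] dvd_trans by blast
    ultimately have "gen_poly d w \<phi> = 0"
      using bound by (auto simp: vanishing_bound_def)
    then have "Poly_Mapping.lookup (ell ^ d :: ('n, 'k) mvpoly) m = 0"
      using coeff_gen_poly[OF w m, of \<phi>] \<phi>(3) by simp
    then show False using lookup_ell_power_nonzero[OF m] by blast
  qed
  then have "p \<in> W" using S_piece_subset_ideal[OF W] p by blast
  then show ?thesis
    unfolding W_def by (rule adjoin_S_piece[OF hom S_piece_power[OF curve_in_S_piece] i p])
qed

text \<open>A functional that vanishes on \<open>I\<close> but not on some monomial of degree
  \<open>k\<close> gives a nonzero \<open>gen_poly\<close>, and \<open>gen_poly_dvd\<close> with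
  both exponents equal to \<open>k\<close> makes every bad \<open>t\<close> one of its
  roots.\<close>

lemma finite_curve_power_in_ideal:
  fixes I :: "('n::finite, 'k::field_char_0) mvpoly set"
  assumes I: "ideal I S_ring" and "\<not> S_piece k \<subseteq> I"
    and w: "inj_on (weight w) {m. mon_deg m = k}"
  shows "finite {t. curve w t ^ k \<in> I}"
proof -
  obtain m where m: "mon_deg m = k" "monomial m \<notin> I"
    using S_piece_subset_ideal[OF I] assms(2) by blast
  then obtain \<phi> where \<phi>: "linear_functional \<phi>" "\<And>p. p \<in> I \<Longrightarrow> \<phi> p = 0" "\<phi> (monomial m) = 1"
    using ex_linear_functional[of I "monomial m"] ideal_0[OF I] ideal_add[OF I] ideal_mult[OF I]
    by blast
  have "coeff (gen_poly k w \<phi>) (weight w m) \<noteq> 0"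
    unfolding coeff_gen_poly[OF w m(1)] using \<phi>(3) lookup_ell_power_nonzero[OF m(1)] by simp
  then have "gen_poly k w \<phi> \<noteq> 0" by auto
  then have "finite {t. poly (gen_poly k w \<phi>) t = 0}" by (rule poly_roots_finite)
  moreover have "poly (gen_poly k w \<phi>) t = 0" if "curve w t ^ k \<in> I" for t
  proof -
    have "\<phi> (curve w t ^ k * q) = 0" for q
      by (rule \<phi>(2)) (use ideal_mult[OF I that, of q] in \<open>simp add: mult.commute\<close>)
    then have "[:- t, 1:] ^ (k - k + 1) dvd gen_poly k w \<phi>"
      by (intro gen_poly_dvd \<phi>(1)) auto
    then show ?thesis by (simp add: poly_eq_0_iff_dvd)
  qed
  ultimately show ?thesis by (auto elim: rev_finite_subset)
qed

section \<open>Lower bounds for the Hilbert function\<close>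

lemma lincomb_eq_sum:
  "length cs = length qs \<Longrightarrow> lincomb cs qs = (\<Sum>j<length qs. const (cs ! j) * qs ! j)"
  by (induction cs qs rule: lincomb.induct) (simp_all add: sum.lessThan_Suc_shift del: sum.lessThan_Suc)

text \<open>Every monomial of degree \<open>k\<close> is a multiple of one of degree
  \<open>d\<close>.\<close>

lemma adjoin_S_piece_mono:
  fixes I :: "('n::finite, 'k::field_char_0) mvpoly set"
  assumes I: "ideal I S_ring" and "S_piece d \<subseteq> adjoin I f" and "d \<le> k"
  shows "S_piece k \<subseteq> adjoin I f"
proof (rule S_piece_subset_ideal[OF ideal_adjoin[OF I]])
  fix m :: "'n \<Rightarrow>\<^sub>0 nat" assume "mon_deg m = k"
  with assms(3) obtain a b where m: "m = a + b" "mon_deg b = d"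
    using mon_deg_ge_decomp[of d m] by auto
  then have "monomial b \<in> adjoin I f" using assms(2) monomial_in_S_piece by blast
  then show "monomial m \<in> adjoin I f"
    unfolding m(1) monomial_add by (rule ideal_mult[OF ideal_adjoin[OF I]])
qed

lemma eq_0_if_below_degree:
  fixes I :: "('n::finite, 'k::field_char_0) mvpoly set"
  assumes "\<And>p m. p \<in> I \<Longrightarrow> m \<in> Poly_Mapping.keys p \<Longrightarrow> d \<le> mon_deg m"
    and "p \<in> S_piece j" "j < d" "p \<in> I"
  shows "p = 0"
proof -
  have "m \<notin> Poly_Mapping.keys p" for m
    using assms by (fastforce simp: S_piece_def)
  then show ?thesis by (metis ex_in_conv keys_eq_empty)
qed

lemma mult_inj_below:
  fixes I :: "('n::finite, 'k::field_char_0) mvpoly set"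
  assumes I: "ideal I S_ring"
    and deg: "\<And>p m. p \<in> I \<Longrightarrow> m \<in> Poly_Mapping.keys p \<Longrightarrow> d \<le> mon_deg m"
    and l: "l \<in> S_piece 1" "l \<noteq> 0" and j: "j + i < d"
  shows "mult_inj I (l ^ i) j"
  unfolding mult_inj_iff[OF I]
proof (intro ballI impI)
  fix p assume p: "p \<in> S_piece j" "l ^ i * p \<in> I"
  have "l ^ i * p = 0"
    using eq_0_if_below_degree[OF deg S_piece_mult[OF S_piece_power[OF l(1)] p(1)] _ p(2)] j by simp
  then have "p = 0" using mvpoly_no_zero_divisors mvpoly_power_nonzero[OF l(2)] by blast
  then show "p \<in> I" using ideal_0[OF I] by simp
qed

lemma max_rank_if_surj:
  fixes I :: "('n::finite, 'k::field_char_0) mvpoly set"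
  assumes I: "ideal I S_ring" and hom: "homogeneous_set I"
    and deg: "\<And>p m. p \<in> I \<Longrightarrow> m \<in> Poly_Mapping.keys p \<Longrightarrow> d \<le> mon_deg m"
    and l: "l \<in> S_piece 1" "l \<noteq> 0" and surj: "S_piece d \<subseteq> adjoin I (l ^ i)"
  shows "max_rank I (l ^ i) j (j + i)"
proof (cases "j + i < d")
  case True
  then show ?thesis using mult_inj_below[OF I deg l] by (auto simp: max_rank_def)
next
  case False
  have "mult_surj I (l ^ i) j (j + i)"
    unfolding mult_surj_iff[OF I S_piece_power[OF l(1)]]
  proof
    fix q :: "('n, 'k) mvpoly" assume q: "q \<in> S_piece (j + i)"
    then have "q \<in> adjoin I (l ^ i)" using adjoin_S_piece_mono[OF I surj, of "j + i"] False by auto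
    from adjoin_S_piece[OF hom S_piece_power[OF l(1)] _ q this]
    show "\<exists>p\<in>S_piece j. q - l ^ i * p \<in> I" by simp
  qed
  then show ?thesis by (simp add: max_rank_def)
qed

text \<open>Coordinates with respect to a basis of \<open>R_piece I d\<close> are chosen once,
  before \<open>t\<close>. All exceptional \<open>t\<close> then violate
  \<open>vanishing_bound\<close> for one fixed family of polynomials.\<close>

lemma finite_not_surj_curve:
  fixes I :: "('n::finite, 'k::field_char_0) mvpoly set"
  assumes I: "ideal I S_ring" and hom: "homogeneous_set I" and "1 \<notin> I"
    and c: "HF I d \<le> d - i + 1" and i: "i \<le> d"
    and w: "inj_on (weight w) {m. mon_deg m = d}"
  shows "finite {t. \<not> S_piece d \<subseteq> adjoin I (curve w t ^ i)}"
proof -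
  obtain qs where qs: "length qs = HF I d"
    "\<And>p. p \<in> S_piece d \<Longrightarrow> \<exists>cs. length cs = length qs \<and> p - lincomb cs qs \<in> I"
    using R_piece_spanning[OF I assms(3), of d] by metis
  have "\<exists>cs. length cs = length qs \<and> monomial m - lincomb cs qs \<in> I" if "mon_deg m = d" for m
    using qs(2) that monomial_in_S_piece by blast
  then obtain cs where cs: "\<And>m. mon_deg m = d \<Longrightarrow>
      length (cs m) = length qs \<and> monomial m - lincomb (cs m) qs \<in> I"
    by metis
  have rep: "monomial m - (\<Sum>j<HF I d. const (cs m ! j) * qs ! j) \<in> I" if "mon_deg m = d" for m
    using cs[OF that] lincomb_eq_sum[of "cs m" qs] qs(1) by simp
  let ?F = "\<lambda>j. \<Sum>m\<in>{m. mon_deg m = d}.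
      monom (Poly_Mapping.lookup (ell ^ d :: ('n, 'k) mvpoly) m * cs m ! j) (weight w m)"
  have "S_piece d \<subseteq> adjoin I (curve w t ^ i)" if "vanishing_bound t (HF I d) ?F" for t
    using curve_power_surj[OF I hom rep c i w that] unfolding mem_adjoin_iff subset_iff by blast
  then have "{t. \<not> S_piece d \<subseteq> adjoin I (curve w t ^ i)} \<subseteq> {t. \<not> vanishing_bound t (HF I d) ?F}"
    by blast
  then show ?thesis using finite_not_vanishing_bound finite_subset by blast
qed

text \<open>For a monomial ideal the basis consists of monomials and the coordinates are 0 or 1, so
  each coordinate polynomial is a single power of \<open>T\<close> up to a scalar. The bound then
  holds at \<open>t = 1\<close>, where the curve passes through \<open>ell\<close>.\<close>

lemma ell_power_surj_monomial:
  fixes I :: "('n::finite, 'k::field_char_0) mvpoly set"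
  assumes I: "ideal I S_ring" and hom: "homogeneous_set I" and "1 \<notin> I"
    and U: "I = {p. Poly_Mapping.keys p \<subseteq> U}"
    and c: "HF I d \<le> d - i + 1" and i: "i \<le> d"
  shows "S_piece d \<subseteq> adjoin I (ell ^ i)"
proof -
  obtain w :: "'n \<Rightarrow> nat" where w: "inj_on (weight w) {m. mon_deg m = d}"
    using ex_separating_weight[OF finite_mon_deg] by blast
  obtain xs where xs: "set xs = {m :: 'n \<Rightarrow>\<^sub>0 nat. mon_deg m = d} - U" "distinct xs"
    using finite_distinct_list[OF finite_Diff[OF finite_mon_deg]] by blast
  have len: "length xs = HF I d"
    using HF_monomial_ideal[OF I assms(3) U, of d] xs distinct_card by metis
  define a :: "('n \<Rightarrow>\<^sub>0 nat) \<Rightarrow> nat \<Rightarrow> 'k" where "a m j = (if xs ! j = m then 1 else 0)" for m j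
  have rep: "monomial m - (\<Sum>j<HF I d. const (a m j) * monomial (xs ! j)) \<in> I" if m: "mon_deg m = d" for m
  proof (cases "m \<in> U")
    case True
    then have "a m j = 0" if "j < HF I d" for j
      using that xs nth_mem[of j xs] by (auto simp: a_def len)
    moreover have "monomial m \<in> I" using True unfolding U by (simp add: monomial_def)
    ultimately show ?thesis by simp
  next
    case False
    then obtain k where k: "k < HF I d" "xs ! k = m"
      using m xs len by (metis (mono_tags, lifting) DiffI in_set_conv_nth mem_Collect_eq)
    have "(\<Sum>j<HF I d. const (a m j) * monomial (xs ! j)) = (\<Sum>j<HF I d. if j = k then monomial m else 0)"
      using k nth_eq_iff_index_eq[OF xs(2)] by (intro sum.cong) (auto simp: a_def len)
    also have "\<dots> = monomial m" using k by simp
    finally show ?thesis using ideal_0[OF I] by simp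
  qed
  \<comment> \<open>The equation is stated for every index \<open>j\<close>; the value 0 covers an
    index beyond the list, where \<open>xs ! j\<close> is arbitrary and may have another
    degree.\<close>
  have F: "(\<Sum>m\<in>{m. mon_deg m = d}.
      monom (Poly_Mapping.lookup (ell ^ d :: ('n, 'k) mvpoly) m * a m j) (weight w m)) =
      monom (if mon_deg (xs ! j) = d then Poly_Mapping.lookup (ell ^ d :: ('n, 'k) mvpoly) (xs ! j) else 0)
        (weight w (xs ! j))" for j
  proof -
    have "(\<Sum>m\<in>{m. mon_deg m = d}.
      monom (Poly_Mapping.lookup (ell ^ d :: ('n, 'k) mvpoly) m * a m j) (weight w m)) =
      (\<Sum>m\<in>{m. mon_deg m = d}. if xs ! j = m
        then monom (Poly_Mapping.lookup (ell ^ d :: ('n, 'k) mvpoly) m) (weight w m) else 0)"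
      by (rule sum.cong) (auto simp: a_def)
    then show ?thesis by (simp add: finite_mon_deg)
  qed
  have bound: "vanishing_bound 1 (HF I d) (\<lambda>j. \<Sum>m\<in>{m. mon_deg m = d}.
      monom (Poly_Mapping.lookup (ell ^ d :: ('n, 'k) mvpoly) m * a m j) (weight w m))"
    unfolding F by (rule vanishing_bound_monom)
  have "\<exists>r\<in>S_piece (d - i). p - curve w 1 ^ i * r \<in> I" if "p \<in> S_piece d" for p
    by (rule curve_power_surj[OF I hom rep c i w bound that])
  then show ?thesis unfolding curve_1 mem_adjoin_iff subset_iff by blast
qed

text \<open>One linear form has to serve all exponents. Since \<open>2 = d - (d - 1) + 1\<close>, a
  generic \<open>l\<close> makes \<open>l ^ (d - 1)\<close> surjective onto degree \<open>d\<close>,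
  which settles every map from positive degree into degree at least \<open>d\<close>. Maps out of
  degree 0 are settled by choosing \<open>l\<close> with a nonzero power in the top degree of the
  quotient.\<close>

lemma SLP_if_HF_le_2:
  fixes I :: "('n::finite, 'k::field_char_0) mvpoly set"
  assumes art: "artinian I" and hom: "homogeneous_set I"
    and deg: "\<And>p m. p \<in> I \<Longrightarrow> m \<in> Poly_Mapping.keys p \<Longrightarrow> d \<le> mon_deg m"
    and d: "2 \<le> d" and HF: "HF I d \<le> 2"
  shows "SLP I"
proof -
  have I: "ideal I S_ring" using art by (simp add: artinian_def)
  have one: "1 \<notin> I" using deg[of 1 0] d by auto
  \<comment> \<open>From degree \<open>N0\<close> on the quotient is zero; its predecessor
    \<open>N\<close> is the last degree with a nonzero piece.\<close>
  define N0 where "N0 = (LEAST N. \<forall>j\<ge>N. S_piece j \<subseteq> I)"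
  have "\<exists>N. \<forall>j\<ge>N. S_piece j \<subseteq> I"
    using artinian_vanishes[OF art one hom] by metis
  then have top: "S_piece j \<subseteq> I" if "N0 \<le> j" for j
    using that LeastI_ex[of "\<lambda>N. \<forall>j\<ge>N. S_piece j \<subseteq> I"] unfolding N0_def by blast
  have "1 \<in> S_piece 0" by (simp add: S_piece_def)
  then have "N0 \<noteq> 0" using top[of 0] one by auto
  then obtain N where N: "N0 = Suc N" using not0_implies_Suc by blast
  have notN: "\<not> S_piece N \<subseteq> I"
  proof
    assume "S_piece N \<subseteq> I"
    then have "\<forall>j\<ge>N. S_piece j \<subseteq> I" using top N le_eq_less_or_eq by (metis Suc_leI)
    then have "N0 \<le> N" unfolding N0_def by (rule Least_le)
    with N show False by simp
  qed
  obtain w :: "'n \<Rightarrow> nat" where "inj_on (weight w) ({m. mon_deg m = d} \<union> {m. mon_deg m = N})"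
    using ex_separating_weight[OF finite_UnI[OF finite_mon_deg finite_mon_deg]] by blast
  then have w: "inj_on (weight w) {m. mon_deg m = d}" "inj_on (weight w) {m. mon_deg m = N}"
    by (simp_all add: inj_on_Un)
  have "finite ({t. \<not> S_piece d \<subseteq> adjoin I (curve w t ^ (d - 1))} \<union> {t. curve w t ^ N \<in> I} \<union> {0})"
    using finite_not_surj_curve[OF I hom one _ _ w(1), of "d - 1"] d HF
      finite_curve_power_in_ideal[OF I notN w(2)] by simp
  from ex_new_if_finite[OF infinite_UNIV_char_0 this] obtain t where
    t: "S_piece d \<subseteq> adjoin I (curve w t ^ (d - 1))" "curve w t ^ N \<notin> I" "t \<noteq> 0" by auto
  define l where "l = curve w t"
  have l: "l \<in> S_piece 1" "l \<noteq> 0" using curve_in_S_piece curve_nonzero[OF t(3)] unfolding l_def by blast+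
  \<comment> \<open>The condition \<open>e < k\<close> says that the source degree is positive. In
    degree \<open>d\<close> the factor \<open>l ^ e\<close> is split off from
    \<open>l ^ (d - 1)\<close>; in the next degree \<open>p\<close> is first divided by
    \<open>l\<close>, and the induction hypothesis for \<open>e - 1\<close> applies to the
    quotient.\<close>
  have surj: "\<exists>r\<in>S_piece (k - e). p - l ^ e * r \<in> I" if "d \<le> k" "e < k" "p \<in> S_piece k" for k e p
    using that
  proof (induction k arbitrary: e p rule: dec_induct)
    case base
    then have "p \<in> adjoin I (l ^ (d - 1))" using t(1) unfolding l_def by blast
    then obtain r where r: "r \<in> S_piece 1" "p - l ^ (d - 1) * r \<in> I"
      using adjoin_S_piece[OF hom S_piece_power[OF l(1)] _ base(2), of "d - 1"] d by auto
    have "l ^ (d - 1) = l ^ e * l ^ (d - 1 - e)" using base by (simp flip: power_add)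
    then have "p - l ^ e * (l ^ (d - 1 - e) * r) \<in> I" using r(2) by (simp add: mult.assoc)
    moreover have "l ^ (d - 1 - e) * r \<in> S_piece (d - e)"
      using S_piece_mult[OF S_piece_power[OF l(1), of "d - 1 - e"] r(1)] base d
      by (simp add: Suc_diff_Suc)
    ultimately show ?case by blast
  next
    case (step k)
    show ?case
    proof (cases e)
      case 0
      then show ?thesis using step.prems ideal_0[OF I] by (intro bexI[of _ p]) auto
    next
      case (Suc e')
      have "l ^ (d - 1) = l * l ^ (d - 2)"
        using d by (simp flip: power_Suc add: Suc_diff_Suc numeral_2_eq_2)
      then have "S_piece d \<subseteq> adjoin I l"
        using t(1) adjoin_mult_subset[of I l "l ^ (d - 2)"] unfolding l_def[symmetric] by simp
      then obtain r where r: "r \<in> S_piece k" "p - l * r \<in> I"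
        using adjoin_S_piece_mono[OF I, of d l "Suc k"] step
          adjoin_S_piece[OF hom l(1) _ step.prems(2)] by auto
      obtain r' where r': "r' \<in> S_piece (k - e')" "r - l ^ e' * r' \<in> I"
        using step.IH[of e' r] r(1) step.prems(1) Suc by auto
      have "p - l ^ e * r' = (p - l * r) + l * (r - l ^ e' * r')"
        unfolding Suc by (simp add: algebra_simps)
      then have "p - l ^ e * r' \<in> I"
        using ideal_add[OF I r(2) ideal_mult[OF I r'(2)]] by metis
      then show ?thesis using r'(1) Suc by auto
    qed
  qed
  have "max_rank I (l ^ i) j (j + i)" if "1 \<le> i" for i j
  proof (cases "j + i < d")
    case True
    then show ?thesis using mult_inj_below[OF I deg l] by (auto simp: max_rank_def)
  next
    case False
    note surj_iff = mult_surj_iff[OF I S_piece_power[OF l(1)], of i j]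
    show ?thesis
    proof (cases "j = 0")
      case j: False
      then have "mult_surj I (l ^ i) j (j + i)"
        unfolding surj_iff using surj[of "j + i" i] False by auto
      then show ?thesis by (simp add: max_rank_def)
    next
      case True
      show ?thesis
      proof (cases "N0 \<le> i")
        case True
        then have "mult_surj I (l ^ i) j (j + i)"
          unfolding surj_iff using top[of "j + i"] by (auto intro!: bexI[of _ 0])
        then show ?thesis by (simp add: max_rank_def)
      next
        case False
        \<comment> \<open>The piece of degree 0 consists of scalars, so injectivity means that
          \<open>l ^ i\<close> is not in \<open>I\<close>, which holds since its multiple
          \<open>l ^ N\<close> is not.\<close>
        then have "l ^ N = l ^ (N - i) * l ^ i" using N by (simp flip: power_add)
        then have li: "l ^ i \<notin> I" using t(2) ideal_mult[OF I] unfolding l_def by metis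
        have "mult_inj I (l ^ i) j"
          unfolding mult_inj_iff[OF I]
        proof (intro ballI impI)
          fix p assume p: "p \<in> S_piece j" "l ^ i * p \<in> I"
          define c where "c = Poly_Mapping.lookup p 0"
          have pc: "p = const c"
          proof (rule poly_mapping_eqI)
            fix m show "Poly_Mapping.lookup p m = Poly_Mapping.lookup (const c) m"
              using p(1) True by (cases "m = 0") (auto simp: c_def S_piece_def lookup_single when_def in_keys_iff)
          qed
          have "c = 0"
          proof (rule ccontr)
            assume "c \<noteq> 0"
            then have "const (inverse c) * (l ^ i * p) = l ^ i"
              unfolding pc by (simp add: mult.left_commute mult_single)
            then show False using li ideal_mult[OF I p(2)] by metis
          qed
          then show "p \<in> I" using pc ideal_0[OF I] by simp
        qed
        then show ?thesis by (simp add: max_rank_def)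
      qed
    qed
  qed
  then show ?thesis unfolding SLP_def using l(1) by blast
qed

section \<open>Sharpness\<close>

text \<open>The exponents \<open>x\<^sup>k y\<^bsup>e-k\<^esup> z\<^sup>b\<close> with \<open>e = d - b\<close>; the example is the ideal generated by all other
  monomials of degree \<open>d\<close>, with \<open>b = i - 1\<close>.\<close>

definition strip :: "nat \<Rightarrow> nat \<Rightarrow> 'n::finite \<Rightarrow> 'n \<Rightarrow> 'n \<Rightarrow> ('n \<Rightarrow>\<^sub>0 nat) set" where
  "strip d b x y z = {m. mon_deg m = d \<and> Poly_Mapping.lookup m z = b \<and>
     (\<forall>v. v \<notin> {x, y, z} \<longrightarrow> Poly_Mapping.lookup m v = 0)}"

text \<open>The exponent of \<open>x\<close> runs from 0 to \<open>d - b\<close> and determines that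
  of \<open>y\<close>.\<close>

lemma card_strip:
  fixes x y z :: "'n::finite"
  assumes xyz: "x \<noteq> y" "x \<noteq> z" "y \<noteq> z" and b: "b \<le> d"
  shows "card (strip d b x y z) = d - b + 1"
proof -
  define f where "f k = Poly_Mapping.single x k + Poly_Mapping.single y (d - b - k) + Poly_Mapping.single z b" for k
  have lk: "Poly_Mapping.lookup (f k) v =
    (if v = x then k else if v = y then d - b - k else if v = z then b else 0)" for k v
    using xyz by (auto simp: f_def lookup_add lookup_single when_def)
  have "strip d b x y z = f ` {..d - b}"
  proof (intro equalityI subsetI)
    fix m assume m: "m \<in> strip d b x y z"
    have "mon_deg m = (\<Sum>v\<in>{x, y, z}. Poly_Mapping.lookup m v)"
      unfolding mon_deg_def using m by (intro sum.mono_neutral_right) (auto simp: strip_def)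
    then have deg: "Poly_Mapping.lookup m x + Poly_Mapping.lookup m y + b = d"
      using m xyz by (simp add: strip_def)
    have "m = f (Poly_Mapping.lookup m x)"
      using m deg by (intro poly_mapping_eqI) (auto simp: lk strip_def)
    then show "m \<in> f ` {..d - b}" using deg by auto
  next
    fix m assume "m \<in> f ` {..d - b}"
    then obtain k where k: "m = f k" "k \<le> d - b" by auto
    have "mon_deg (f k) = d" using k b by (simp add: f_def)
    then show "m \<in> strip d b x y z" using xyz unfolding k(1) strip_def by (auto simp: lk)
  qed
  moreover have "inj f"
    by (rule injI) (metis lk)
  ultimately show ?thesis
    by (simp add: card_image inj_on_subset)
qed

text \<open>A monomial of degree above \<open>d\<close> has a divisor \<open>m1\<close> of degree
  \<open>d + 1\<close>, and removing one variable from \<open>m1\<close> lands outside the strip: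
  \<open>z\<close> itself if its exponent is \<open>b\<close>, which is positive; otherwise any
  other variable; and if only \<open>z\<close> occurs, then \<open>z^d\<close> remains and
  \<open>b < d\<close>.\<close>

lemma strip_complement_upset:
  assumes z: "1 \<le> b" "b < d"
  shows "{a + m |a m. m \<in> {m. mon_deg m = d} - strip d b x y z} = {m. d \<le> mon_deg m} - strip d b x y z"
    (is "?L = ?R")
proof (intro equalityI subsetI)
  fix m assume "m \<in> ?L"
  then obtain a m' where m: "m = a + m'" "mon_deg m' = d" "m' \<notin> strip d b x y z" by auto
  have "m \<notin> strip d b x y z"
  proof
    assume s: "m \<in> strip d b x y z"
    then have "mon_deg a = 0" using m by (simp add: strip_def)
    with m s show False by simp
  qed
  with m show "m \<in> ?R" by simp
next
  fix m assume m: "m \<in> ?R"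
  show "m \<in> ?L"
  proof (cases "mon_deg m = d")
    case True
    have "m = 0 + m" by simp
    with True m show ?thesis by blast
  next
    case False
    then have "Suc d \<le> mon_deg m" using m by simp
    then obtain a m1 where m1: "m = a + m1" "mon_deg m1 = Suc d" by (rule mon_deg_ge_decomp)
    have "\<exists>v m2. m1 = Poly_Mapping.single v 1 + m2 \<and> Poly_Mapping.lookup m2 z \<noteq> b"
    proof (cases "Poly_Mapping.lookup m1 z = b")
      case True
      then obtain m2 where "m1 = Poly_Mapping.single z 1 + m2"
        using z lookup_pos_decomp[of m1 z] by auto
      with True show ?thesis by (intro exI[of _ z] exI[of _ m2]) (auto simp: lookup_add)
    next
      case False
      show ?thesis
      proof (cases "\<exists>v. v \<noteq> z \<and> Poly_Mapping.lookup m1 v > 0")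
        case True
        then obtain v where v: "v \<noteq> z" "Poly_Mapping.lookup m1 v > 0" by blast
        then obtain m2 where "m1 = Poly_Mapping.single v 1 + m2"
          using lookup_pos_decomp[of m1 v] by auto
        with False v show ?thesis
          by (intro exI[of _ v] exI[of _ m2]) (auto simp: lookup_add lookup_single when_def)
      next
        case False
        have "mon_deg m1 = (\<Sum>v\<in>{z}. Poly_Mapping.lookup m1 v)"
          unfolding mon_deg_def using False by (intro sum.mono_neutral_right) auto
        then have *: "Poly_Mapping.lookup m1 z = Suc d" using m1 by simp
        then obtain m2 where "m1 = Poly_Mapping.single z 1 + m2"
          using lookup_pos_decomp[of m1 z] by auto
        with * z show ?thesis by (intro exI[of _ z] exI[of _ m2]) (auto simp: lookup_add)
      qed
    qed
    then obtain v m2 where m2: "m1 = Poly_Mapping.single v 1 + m2" "Poly_Mapping.lookup m2 z \<noteq> b"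
      by blast
    have "m = (a + Poly_Mapping.single v 1) + m2" unfolding m1(1) m2(1) by (simp add: add.assoc)
    moreover have "m2 \<in> {m. mon_deg m = d} - strip d b x y z"
      using m1(2) m2 by (simp add: strip_def)
    ultimately show ?thesis by blast
  qed
qed

text \<open>Generated by monomials of degree \<open>d\<close>, this ideal belongs to all three
  classes at once. Its quotient in degree \<open>d\<close> is spanned by the strip with
  \<open>b = i - 1\<close>, which has \<open>d - (i - 1) + 1\<close> elements.\<close>

lemma sharp_example:
  fixes x y z :: "'n::finite"
  assumes xyz: "x \<noteq> y" "x \<noteq> z" "y \<noteq> z" and i: "2 \<le> i" "i \<le> d - 1" and d: "3 \<le> d"
  defines "I \<equiv> Idl\<^bsub>S_ring\<^esub> (monomial ` ({m. mon_deg m = d} - strip d (i - 1) x y z)) :: ('n, 'k::field_char_0) mvpoly set"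
  shows "I \<in> artinian_gen_in_degree d" "I \<in> artinian_monomial d" "I \<in> artinian_homogeneous d"
    "HF I d = d - i + 2" "\<not> mult_surj I (ell ^ i) (d - i) d"
proof -
  define M where "M = {m. mon_deg m = d} - strip d (i - 1) x y z"
  define U where "U = {m. d \<le> mon_deg m} - strip d (i - 1) x y z"
  have IM: "I = Idl\<^bsub>S_ring\<^esub> (monomial ` M)" by (simp add: I_def M_def)
  have IU: "I = {p. Poly_Mapping.keys p \<subseteq> U}"
    unfolding IM Idl_monomials M_def U_def
    by (subst strip_complement_upset) (use i in auto)
  have I: "ideal I S_ring" unfolding IM by (rule Idl_is_ideal)
  have one: "1 \<notin> I" using d by (simp add: IU U_def)
  have art: "artinian I"
    by (rule artinianI[OF I one, of d]) (auto simp: IU U_def strip_def monomial_def)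
  have finM: "finite M" unfolding M_def by (rule finite_Diff[OF finite_mon_deg])
  have "Poly_Mapping.single z d \<in> M" using i d by (auto simp: M_def strip_def)
  then have neM: "M \<noteq> {}" by blast
  have degM: "mon_deg ` M = {d}" using neM by (auto simp: M_def)
  have pd: "poly_deg (monomial m :: ('n, 'k) mvpoly) = mon_deg m" for m
    by (simp add: poly_deg_def monomial_def)
  show "I \<in> artinian_gen_in_degree d"
    unfolding artinian_gen_in_degree_def using art IM
    by (auto intro!: exI[of _ "monomial ` M"] simp: monomial_in_S_piece M_def)
  show "I \<in> artinian_monomial d"
    unfolding artinian_monomial_def using art IM finM neM degM
    by (auto intro!: exI[of _ M])
  have "poly_deg ` (monomial ` M :: ('n, 'k) mvpoly set) = {d}"
    unfolding image_image pd degM ..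
  moreover have "f \<noteq> 0 \<and> (\<exists>e. f \<in> S_piece e)" if "f \<in> monomial ` M" for f :: "('n, 'k) mvpoly"
    using that monomial_in_S_piece by (auto simp: monomial_def poly_mapping_eq_iff fun_eq_iff lookup_single)
  ultimately show "I \<in> artinian_homogeneous d"
    unfolding artinian_homogeneous_def using art IM finM neM
    by (auto intro!: exI[of _ "monomial ` M"])
  have "{m. mon_deg m = d} - U = strip d (i - 1) x y z" by (auto simp: U_def strip_def)
  then show "HF I d = d - i + 2"
    using HF_monomial_ideal[OF I one IU, of d] card_strip[OF xyz, of "i - 1" d] i by simp
  show "\<not> mult_surj I (ell ^ i) (d - i) d"
  proof
    assume surj: "mult_surj I (ell ^ i) (d - i) d"
    txt \<open>Substituting \<open>x \<mapsto> -1\<close>, \<open>y \<mapsto> 1\<close>, \<open>z \<mapsto> T\<close> and \<open>0\<close> for the other variables sends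
      \<open>ell\<close> to \<open>T\<close>. On degree \<open>d\<close> the coefficient of \<open>T\<^bsup>i-1\<^esup>\<close> then sees only the monomials outside the
      ideal, and it vanishes on multiples of \<open>ell\<^sup>i\<close>.\<close>
    define a :: "'n \<Rightarrow> 'k" where "a v = (if v = x then -1 else if v = y \<or> v = z then 1 else 0)" for v
    define \<delta> :: "'n \<Rightarrow> nat" where "\<delta> v = (if v = z then 1 else 0)" for v
    interpret substitution "\<lambda>c::'k. [:c:]" "\<lambda>v::'n. monom (a v) (\<delta> v)"
      by unfold_locales auto
    have val: "mon_val m = monom (\<Prod>v\<in>UNIV. a v ^ Poly_Mapping.lookup m v) (Poly_Mapping.lookup m z)" for m
      unfolding mon_val_def monom_power prod_monom[OF finite]
      by (simp add: \<delta>_def if_distrib[of "\<lambda>k. k * _"] cong: if_cong)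
    have "subst_hom ell = (\<Sum>v\<in>{x, y, z}. monom (a v) (\<delta> v))"
      unfolding subst_hom_ell by (rule sum.mono_neutral_right) (auto simp: a_def)
    also have "\<dots> = monom 1 1" using xyz by (simp add: a_def \<delta>_def flip: minus_monom)
    finally have ell: "subst_hom (ell ^ i * p) = monom 1 i * subst_hom p" for p
      by (simp add: subst_hom_mult subst_hom_power monom_power)
    \<comment> \<open>A monomial of the strip whose image is a nonzero multiple of
      \<open>T^(i-1)\<close>; it is shown not to lie in the image of \<open>ell ^ i\<close>.\<close>
    define m where "m = Poly_Mapping.single x (d - i + 1) + Poly_Mapping.single z (i - 1)"
    have m: "mon_deg m = d" using i by (simp add: m_def)
    have "d = d - i + i" using i by simp
    then obtain p where p: "p \<in> S_piece (d - i)" "monomial m - ell ^ i * p \<in> I"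
      using surj mult_surj_iff[OF I S_piece_power[OF ell_in_S_piece, of i], of "d - i"] m monomial_in_S_piece
      by metis
    define r where "r = monomial m - ell ^ i * p"
    have "ell ^ i * p \<in> S_piece d"
      using S_piece_mult[OF S_piece_power[OF ell_in_S_piece, of i] p(1)] i by simp
    then have r: "r \<in> S_piece d" unfolding r_def using m by (intro S_piece_diff) (simp_all add: monomial_in_S_piece)
    have "coeff (mon_val k) (i - 1) = 0" if k: "k \<in> Poly_Mapping.keys r" for k
    proof (cases "Poly_Mapping.lookup k z = i - 1")
      case True
      have "mon_deg k = d" using r k by (simp add: S_piece_def)
      moreover have "k \<notin> strip d (i - 1) x y z" using p(2) k unfolding r_def IU U_def by auto
      ultimately obtain v where v: "v \<notin> {x, y, z}" "Poly_Mapping.lookup k v \<noteq> 0"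
        using True by (auto simp: strip_def)
      then have "(\<Prod>v\<in>UNIV. a v ^ Poly_Mapping.lookup k v) = 0"
        by (intro prod_zero) (auto simp: a_def intro!: bexI[of _ v])
      then show ?thesis by (simp add: val)
    qed (simp add: val)
    then have "coeff (subst_hom r) (i - 1) = 0"
      by (simp add: subst_hom_def coeff_sum)
    moreover have "monomial m = r + ell ^ i * p" by (simp add: r_def)
    then have "subst_hom (monomial m) = subst_hom r + monom 1 i * subst_hom p"
      by (simp add: subst_hom_add ell)
    moreover have "coeff (monom 1 i * subst_hom p) (i - 1) = 0"
      using i by (simp add: coeff_monom_mult)
    ultimately have "coeff (subst_hom (monomial m)) (i - 1) = 0" by simp
    moreover have "Poly_Mapping.lookup m z = i - 1"
      using xyz by (simp add: m_def lookup_add lookup_single when_def)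
    moreover have "(\<Prod>v\<in>UNIV. a v ^ Poly_Mapping.lookup m v) \<noteq> 0"
      by (auto simp: a_def m_def lookup_add lookup_single when_def)
    ultimately show False by (simp add: monomial_def subst_hom_single val)
  qed
qed

lemma artinian_monomial_keys:
  fixes I :: "('n::finite, 'k::field_char_0) mvpoly set"
  assumes "I \<in> artinian_monomial d"
  obtains U where "I = {p. Poly_Mapping.keys p \<subseteq> U}"
  using assms Idl_monomials unfolding artinian_monomial_def by blast

text \<open>For monomial ideals the bound in terms of \<open>i\<close> is about \<open>ell\<close>
  itself, because \<open>t = 1\<close> is never exceptional. For the other two classes failure is
  assumed for every linear form: the argument provides a good \<open>t\<close> outside a finite set
  and gives no control at \<open>t = 1\<close>. Sharpness of the bound 3 is the case
  \<open>i = d - 1\<close>.\<close>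

theorem theorem4:
  fixes d :: nat
  assumes n: "card (UNIV :: 'n::finite set) \<ge> 3" and d: "d \<ge> 3"
  shows
    "(\<forall>I :: ('n::finite, 'k::field_char_0) mvpoly set.
        I \<in> artinian_gen_in_degree d \<union> artinian_monomial d \<union> artinian_homogeneous d \<longrightarrow>
        \<not> SLP I \<longrightarrow> HF I d \<ge> 3)
     \<and>
     (\<forall>C \<in> {artinian_gen_in_degree d, artinian_monomial d, artinian_homogeneous d}.
        \<exists>I :: ('n, 'k) mvpoly set. I \<in> C \<and> HF I d = 3 \<and> \<not> mult_surj I (ell ^ (d - 1)) 1 d)
     \<and>
     (\<forall>i. 1 \<le> i \<and> i \<le> d - 1 \<longrightarrow>
        (\<forall>I :: ('n, 'k) mvpoly set.
           I \<in> artinian_monomial d \<longrightarrow>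
           (\<exists>j. \<not> max_rank I (ell ^ i) j (j + i)) \<longrightarrow>
           HF I d \<ge> d - i + 2)
        \<and>
        (\<forall>I :: ('n, 'k) mvpoly set.
           I \<in> artinian_gen_in_degree d \<union> artinian_homogeneous d \<longrightarrow>
           (\<forall>l \<in> S_piece 1. \<exists>j. \<not> max_rank I (l ^ i) j (j + i)) \<longrightarrow>
           HF I d \<ge> d - i + 2))
     \<and>
     (\<forall>i. 2 \<le> i \<and> i \<le> d - 1 \<longrightarrow>
        (\<forall>C \<in> {artinian_gen_in_degree d, artinian_monomial d, artinian_homogeneous d}.
           \<exists>I :: ('n, 'k) mvpoly set.
             I \<in> C \<and> \<not> mult_surj I (ell ^ i) (d - i) d \<and> HF I d = d - i + 2))"
proof -
  have one: "1 \<notin> I" if "I \<in> artinian_gen_in_degree d \<union> artinian_monomial d \<union> artinian_homogeneous d"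
    for I :: "('n, 'k) mvpoly set"
    using ideal_classes(4)[OF that, of 1 0] d by auto
  have SLP: "3 \<le> HF I d"
    if C: "I \<in> artinian_gen_in_degree d \<union> artinian_monomial d \<union> artinian_homogeneous d" and "\<not> SLP I"
    for I :: "('n, 'k) mvpoly set"
  proof (rule ccontr)
    assume "\<not> 3 \<le> HF I d"
    then have "SLP I"
      using d by (intro SLP_if_HF_le_2[OF ideal_classes(1,3,4)[OF C]]) auto
    with that(2) show False ..
  qed
  have mono: "d - i + 2 \<le> HF I d"
    if i: "1 \<le> i" "i \<le> d - 1" and M: "I \<in> artinian_monomial d"
      and rank: "\<exists>j. \<not> max_rank I (ell ^ i) j (j + i)"
    for i and I :: "('n, 'k) mvpoly set"
  proof (rule ccontr)
    assume HF: "\<not> d - i + 2 \<le> HF I d"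
    have C: "I \<in> artinian_gen_in_degree d \<union> artinian_monomial d \<union> artinian_homogeneous d"
      using M by blast
    obtain U where U: "I = {p. Poly_Mapping.keys p \<subseteq> U}" using artinian_monomial_keys[OF M] .
    have surj: "S_piece d \<subseteq> adjoin I (ell ^ i)"
      using HF i by (intro ell_power_surj_monomial[OF ideal_classes(2,3)[OF C] one[OF C] U]) auto
    have "ell \<noteq> (0 :: ('n, 'k) mvpoly)"
      using curve_nonzero[of "1 :: 'k" "\<lambda>_ :: 'n. 0"] by (simp add: curve_1)
    then have "max_rank I (ell ^ i) j (j + i)" for j
      by (intro max_rank_if_surj[OF ideal_classes(2,3)[OF C] _ ell_in_S_piece _ surj] ideal_classes(4)[OF C])
    with rank show False by blast
  qed
  have gen: "d - i + 2 \<le> HF I d"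
    if i: "1 \<le> i" "i \<le> d - 1"
      and C: "I \<in> artinian_gen_in_degree d \<union> artinian_monomial d \<union> artinian_homogeneous d"
      and rank: "\<forall>l\<in>S_piece 1. \<exists>j. \<not> max_rank I (l ^ i) j (j + i)"
    for i and I :: "('n, 'k) mvpoly set"
  proof (rule ccontr)
    assume HF: "\<not> d - i + 2 \<le> HF I d"
    obtain w :: "'n \<Rightarrow> nat" where w: "inj_on (weight w) {m. mon_deg m = d}"
      using ex_separating_weight[OF finite_mon_deg] by blast
    \<comment> \<open>Any \<open>t\<close> outside this set yields a nonzero linear form whose
      \<open>i\<close>-th power has maximal rank in all degrees, against
      \<open>rank\<close>.\<close>
    have "finite ({t. \<not> S_piece d \<subseteq> adjoin I (curve w t ^ i)} \<union> {0})"
      using finite_not_surj_curve[OF ideal_classes(2,3)[OF C] one[OF C] _ _ w, of i] HF i by simp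
    from ex_new_if_finite[OF infinite_UNIV_char_0 this] obtain t where
      t: "S_piece d \<subseteq> adjoin I (curve w t ^ i)" "t \<noteq> 0" by auto
    have "max_rank I (curve w t ^ i) j (j + i)" for j
      by (intro max_rank_if_surj[OF ideal_classes(2,3)[OF C] _ curve_in_S_piece curve_nonzero[OF t(2)] t(1)]
          ideal_classes(4)[OF C])
    with rank show False using curve_in_S_piece by blast
  qed
  obtain x y z :: 'n where xyz: "x \<noteq> y" "x \<noteq> z" "y \<noteq> z"
  proof -
    obtain T :: "'n set" where "card T = 3" using n obtain_subset_with_card_n by blast
    then show ?thesis using that by (auto simp: card_3_iff)
  qed
  have sharp: "\<exists>I :: ('n, 'k) mvpoly set. I \<in> C \<and> \<not> mult_surj I (ell ^ i) (d - i) d \<and> HF I d = d - i + 2"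
    if i: "2 \<le> i" "i \<le> d - 1"
      and C: "C \<in> {artinian_gen_in_degree d, artinian_monomial d, artinian_homogeneous d}"
    for i and C :: "('n, 'k) mvpoly set set"
    using sharp_example[OF xyz i d, where 'k = 'k] C by blast
  have "\<exists>I :: ('n, 'k) mvpoly set. I \<in> C \<and> HF I d = 3 \<and> \<not> mult_surj I (ell ^ (d - 1)) 1 d"
    if C: "C \<in> {artinian_gen_in_degree d, artinian_monomial d, artinian_homogeneous d}"
    for C :: "('n, 'k) mvpoly set set"
  proof -
    have "2 \<le> d - 1" "d - 1 \<le> d - 1" "d - (d - 1) = 1" "(1 :: nat) + 2 = 3" using d by auto
    with sharp[OF this(1,2) C] show ?thesis by metis
  qed
  note base_sharp = this
  show ?thesis
  proof (intro conjI allI impI ballI)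
    show "3 \<le> HF I d"
      if "I \<in> artinian_gen_in_degree d \<union> artinian_monomial d \<union> artinian_homogeneous d" "\<not> SLP I"
      for I :: "('n, 'k) mvpoly set"
      using that by (rule SLP)
    show "d - i + 2 \<le> HF I d"
      if "1 \<le> i \<and> i \<le> d - 1" "I \<in> artinian_monomial d" "\<exists>j. \<not> max_rank I (ell ^ i) j (j + i)"
      for i and I :: "('n, 'k) mvpoly set"
      using that by (intro mono) auto
    show "d - i + 2 \<le> HF I d"
      if "1 \<le> i \<and> i \<le> d - 1" "I \<in> artinian_gen_in_degree d \<union> artinian_homogeneous d"
        "\<forall>l\<in>S_piece 1. \<exists>j. \<not> max_rank I (l ^ i) j (j + i)"
      for i and I :: "('n, 'k) mvpoly set"
      using that by (intro gen) auto
  qed (use base_sharp sharp in simp_all)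
qed

end
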